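(* Let $M$ be a nondegenerate vector space of dimension $2$ of skew-symmetric matrices of order $N+1$ over $\mathbf{k}$, of constant rank $2r$. Then $M$ is $SL(N+1)$-equivalent, by congruence (equivalently, by strict equivalence), to one of the pencils $M_{(r_1,\dots,r_h)}$ defined in the context: that is, there exist a partition $r=r_1+\cdots+r_h$ with $r_1\ge r_2\ge\cdots\ge r_h\ge 1$ and $N=2r+h-1$, and a matrix $P\in SL(N+1)$, such that $P^{t}MP=M_{(r_1,\dots,r_h)}$.
   Context: $\mathbf{k}$ is an algebraically closed field of characteristic $0$, $V=\mathbf{k}^{N+1}$, and $r\ge 1$. A vector space $M$ of matrices of order $N+1$ has constant rank $2r$ if every nonzero element of $M$ has rank $2r$. $M$ is nondegenerate if the kernels (in $V$) of the matrices of $M$ intersect in the zero subspace and the images of the elements of $M$ generate $V$. The group $SL(N+1)$ acts on vector spaces of skew-symmetric matrices by congruence, $M\mapsto P^{t}MP=\{P^tAP: A\in M\}$. Two pencils $aA+bB$ and $aA_1+bB_1$ are strictly equivalent if $P(aA+bB)Q=aA_1+bB_1$ for some nonsingular constant matrices $P,Q$; for skew-symmetric pencils strict equivalence and congruence are the same relation. For a partition $r=r_1+\cdots+r_h$, $r_1\ge\cdots\ge r_h\ge 1$, put $N=2r+h-1$. For each $i$ let $U_{r_i}$ be the $r_i\times(r_i+1)$ matrix of linear forms in $a,b$ with entries $(U_{r_i})_{j,j}=a$, $(U_{r_i})_{j,j+1}=b$ for $1\le j\le r_i$ and all other entries $0$. Let $\overline{F}$ be the $r\times(r+h)$ block-diagonal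 matrix with diagonal blocks $U_{r_1},\dots,U_{r_h}$, and let $$F=\begin{pmatrix}0_r&\overline{F}\\-\overline{F}^{t}&0_{N+1-r}\end{pmatrix},$$ a skew-symmetric matrix of order $N+1$, where $0_k$ is the zero matrix of order $k$. Then $M_{(r_1,\dots,r_h)}$ denotes the $2$-dimensional vector space of skew-symmetric matrices obtained from $F$ as $(a,b)$ varies in $\mathbf{k}^2$. *)

theory Defs
  imports
    "HOL-Computational_Algebra.Polynomial"
    "Jordan_Normal_Form.Matrix_Kernel"
    "Jordan_Normal_Form.DL_Rank"
begin

definition skew_symmetric_mat :: "'a::field mat \<Rightarrow> bool" where
  "skew_symmetric_mat A \<longleftrightarrow> A\<^sup>T = - A"

text \<open>The library's notions of subspace and dimension take a module record; a set \<open>M\<close> of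
  matrices becomes a vector space of its own by restricting the carrier of the record of
  all \<open>n \<times> n\<close> matrices to \<open>M\<close>.\<close>

definition matrix_subspace :: "nat \<Rightarrow> 'a::field mat set \<Rightarrow> bool" where
  "matrix_subspace n M \<longleftrightarrow> VectorSpace.subspace class_ring M (module_mat TYPE('a) n n)"

definition matrix_subspace_dim :: "nat \<Rightarrow> 'a::field mat set \<Rightarrow> nat" where
  "matrix_subspace_dim n M =
     vectorspace.dim class_ring ((module_mat TYPE('a) n n)\<lparr>carrier := M\<rparr>)"

definition constant_rank :: "nat \<Rightarrow> nat \<Rightarrow> 'a::field mat set \<Rightarrow> bool" where
  "constant_rank n k M \<longleftrightarrow> (\<forall>A\<in>M. A \<noteq> 0\<^sub>m n n \<longrightarrow> vec_space.rank n A = k)"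

definition nondegenerate_space :: "nat \<Rightarrow> 'a::field mat set \<Rightarrow> bool" where
  "nondegenerate_space n M \<longleftrightarrow>
     (\<Inter>A\<in>M. mat_kernel A) = {0\<^sub>v n} \<and>
     LinearCombinations.module.span class_ring (module_vec TYPE('a) n)
       (\<Union>A\<in>M. (\<lambda>v. A *\<^sub>v v) ` carrier_vec n) = carrier_vec n"

definition special_linear :: "nat \<Rightarrow> 'a::field mat set" where
  "special_linear n = {P \<in> carrier_mat n n. det P = 1}"

definition congruence_action :: "'a::field mat \<Rightarrow> 'a mat set \<Rightarrow> 'a mat set" where
  "congruence_action P M = (\<lambda>A. P\<^sup>T * A * P) ` M"

definition U_block :: "'a::field \<Rightarrow> 'a \<Rightarrow> nat \<Rightarrow> 'a mat" where
  "U_block a b k =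
     mat k (k + 1) (\<lambda>(i, j). if j = i then a else if j = i + 1 then b else 0)"

definition F_bar :: "'a::field \<Rightarrow> 'a \<Rightarrow> nat list \<Rightarrow> 'a mat" where
  "F_bar a b rs = diag_block_mat (map (U_block a b) rs)"

text \<open>With \<open>r = sum_list rs\<close>, \<open>h = length rs\<close> and \<open>N = 2 r + h - 1\<close>, the order
  \<open>N + 1 - r\<close> of the lower right zero block is \<open>r + h\<close>.\<close>

definition F_mat :: "'a::field \<Rightarrow> 'a \<Rightarrow> nat list \<Rightarrow> 'a mat" where
  "F_mat a b rs =
     (let r = sum_list rs; h = length rs in
      four_block_mat (0\<^sub>m r r) (F_bar a b rs) (- (F_bar a b rs)\<^sup>T) (0\<^sub>m (r + h) (r + h)))"

definition M_pencil :: "nat list \<Rightarrow> 'a::field mat set" where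
  "M_pencil rs = {F_mat a b rs | a b. True}"

text \<open>A partition of \<open>r\<close>, written as a weakly decreasing list of positive parts.\<close>

definition decreasing_partition :: "nat \<Rightarrow> nat list \<Rightarrow> bool" where
  "decreasing_partition r rs \<longleftrightarrow>
     sum_list rs = r \<and> sorted_wrt (\<ge>) rs \<and> (\<forall>k\<in>set rs. k \<ge> 1)"

end

theory Submission
  imports Defs "Jordan_Normal_Form.Char_Poly"
begin

text \<open>
  Write the space as \<open>{a A + b B}\<close> and let \<open>n = N + 1\<close>.  The proof splits off one block at a time,
  starting from a polynomial vector \<open>\<Sum>i\<le>k. t\<^sup>i x i\<close> of least degree \<open>k\<close> in the kernel of \<open>t A - B\<close>.
  Its coefficients form a chain \<open>B x 0 = 0\<close>, \<open>A x i = B x (i + 1)\<close>, \<open>A x k = 0\<close>.  Such a vector exists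
  because constant rank over an algebraically closed field makes \<open>det (t A - B)\<close> vanish identically:
  otherwise \<open>A\<close> would be invertible and an eigenvalue of \<open>A\<^sup>-\<^sup>1 B\<close> would give a member of smaller
  rank (\<open>pencil_singular_if_kernel_dim_constant\<close>, \<open>has_chain_if_pencil_singular\<close>).

  Minimality of \<open>k\<close> is used through duality (\<open>dual_sequence_exists\<close>).  Consider sequences
  \<open>y 0, \<dots>, y (k - 1)\<close> with \<open>A y (j + 1) = B y j\<close>.  If \<open>y 0 \<bullet> A x 0\<close> vanished on all of them, it would be
  a combination of these equations, and the coefficients of the combination would make up a
  chain of degree \<open>k - 1\<close>.  So there is such a sequence with \<open>y 0 \<bullet> A x 0 = 1\<close>, and then skew symmetry
  leaves no freedom: the scalar products of the vectors \<open>y j\<close> and \<open>x i\<close> under \<open>A\<close> and \<open>B\<close> are exactly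
  those of the canonical block of size \<open>2 k + 1\<close> (locale \<open>dual_chain\<close>).  In particular
  the \<open>y j\<close> automatically span an isotropic subspace for both forms.

  The same vectors \<open>A x i\<close>, \<open>A y j\<close>, \<open>B y (k - 1)\<close> that give the coordinates on the span of the block
  also cut out its common orthogonal space for \<open>A\<close> and \<open>B\<close>.  Hence \<open>V\<close> is the orthogonal direct sum of
  the block and this complement (\<open>complement_exists\<close>).  The block has a one-dimensional kernel
  for every \<open>(a, b) \<noteq> 0\<close> (\<open>kernel_dim_F_mat_single\<close>), so the restriction to the complement again has
  constant kernel dimension, and it is again nondegenerate; induction on \<open>n\<close> gives
  \<open>normal_basis_exists\<close>.  Chains of the complement are chains of \<open>V\<close>, so by minimality of \<open>k\<close> the
  degrees split off later are at least \<open>k\<close>, which orders the partition.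

  The number of blocks is the kernel dimension \<open>n - 2 r\<close>, and since a block of degree \<open>k\<close> uses
  \<open>2 k + 1\<close> vectors, the degrees add up to \<open>r\<close>.
  Scaling the matrix of the normal basis by an \<open>n\<close>-th root makes its determinant \<open>1\<close>; this
  multiplies all matrices of the pencil by one scalar and leaves the space unchanged.
\<close>

section \<open>Scalar products and biorthogonal systems\<close>

lemma vec_eq_if_scalar_prods_eq:
  fixes v w :: "'a::comm_ring_1 vec"
  assumes v: "v \<in> carrier_vec n" and w: "w \<in> carrier_vec n"
    and eq: "\<And>u. u \<in> carrier_vec n \<Longrightarrow> u \<bullet> v = u \<bullet> w"
  shows "v = w"
proof (rule eq_vecI)
  show "dim_vec v = dim_vec w" using v w by simp
  fix i assume "i < dim_vec w"
  hence i: "i < n" using w by simp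
  show "v $ i = w $ i" using eq[of "unit_vec n i"] i v w by simp
qed

lemma smult_mat_mult_vec:
  fixes A :: "'a::comm_ring_1 mat"
  assumes "A \<in> carrier_mat m n" "v \<in> carrier_vec n"
  shows "(a \<cdot>\<^sub>m A) *\<^sub>v v = a \<cdot>\<^sub>v (A *\<^sub>v v)"
  using assms by (intro eq_vecI) auto

text \<open>The sole operation on \<open>U\<close> is \<open>comb c u w\<close>, to be read as \<open>u + c w\<close>.  On a common
  kernel of all but one functional \<open>f\<close> the statement is known by induction, and the
  remaining functional is then determined up to a factor by one vector \<open>w\<close> with
  \<open>f w \<noteq> 0\<close>.\<close>

lemma functional_vanishing_on_common_kernel:
  fixes f :: "'i \<Rightarrow> 'v \<Rightarrow> 'a::field" and g :: "'v \<Rightarrow> 'a" and U :: "'v set"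
    and comb :: "'a \<Rightarrow> 'v \<Rightarrow> 'v \<Rightarrow> 'v"
  assumes "finite I"
    and "\<And>c u w. u \<in> U \<Longrightarrow> w \<in> U \<Longrightarrow> comb c u w \<in> U"
    and "\<And>i c u w. i \<in> I \<Longrightarrow> u \<in> U \<Longrightarrow> w \<in> U \<Longrightarrow> f i (comb c u w) = f i u + c * f i w"
    and "\<And>c u w. u \<in> U \<Longrightarrow> w \<in> U \<Longrightarrow> g (comb c u w) = g u + c * g w"
    and "\<And>u. u \<in> U \<Longrightarrow> (\<And>i. i \<in> I \<Longrightarrow> f i u = 0) \<Longrightarrow> g u = 0"
  shows "\<exists>c. \<forall>u\<in>U. g u = (\<Sum>i\<in>I. c i * f i u)"
  using assms
proof (induction I arbitrary: U rule: finite_induct)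
  case empty
  thus ?case by auto
next
  case (insert k I)
  define U' where "U' = {u \<in> U. f k u = 0}"
  have "\<exists>c. \<forall>u\<in>U'. g u = (\<Sum>i\<in>I. c i * f i u)"
  proof (rule insert.IH)
    fix u assume "u \<in> U'" "\<And>i. i \<in> I \<Longrightarrow> f i u = 0"
    thus "g u = 0" using insert.prems(4)[of u] by (auto simp: U'_def)
  qed (use insert.prems(1-3) in \<open>auto simp: U'_def\<close>)
  then obtain c where c: "\<And>u. u \<in> U' \<Longrightarrow> g u = (\<Sum>i\<in>I. c i * f i u)" by blast
  show ?case
  proof (cases "\<exists>w\<in>U. f k w \<noteq> 0")
    case False
    hence "U' = U" by (auto simp: U'_def)
    hence "\<forall>u\<in>U. g u = (\<Sum>i\<in>insert k I. c i * f i u)"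
      using c insert.hyps False by auto
    thus ?thesis by blast
  next
    case True
    then obtain w where w: "w \<in> U" and fw: "f k w \<noteq> 0" by blast
    define d where "d = (g w - (\<Sum>i\<in>I. c i * f i w)) / f k w"
    have "g u = (\<Sum>i\<in>insert k I. (c(k := d)) i * f i u)" if u: "u \<in> U" for u
    proof -
      \<comment> \<open>Subtract the multiple of \<open>w\<close> that moves \<open>u\<close> into the kernel of \<open>f k\<close>.\<close>
      define a where "a = - f k u / f k w"
      have U': "comb a u w \<in> U'"
        using insert.prems(1,2) u w fw by (simp add: U'_def a_def)
      have "g u + a * g w = (\<Sum>i\<in>I. c i * (f i u + a * f i w))"
        using c[OF U'] insert.prems(2,3) u w by simp
      hence "g u = (\<Sum>i\<in>I. c i * f i u) - a * (g w - (\<Sum>i\<in>I. c i * f i w))"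
        by (simp add: algebra_simps sum.distrib sum_distrib_left)
      also have "\<dots> = (\<Sum>i\<in>I. c i * f i u) + d * f k u"
        using fw by (simp add: a_def d_def)
      also have "(\<Sum>i\<in>I. c i * f i u) = (\<Sum>i\<in>I. (c(k := d)) i * f i u)"
        using insert.hyps by (intro sum.cong) auto
      finally show ?thesis using insert.hyps by (simp add: add.commute)
    qed
    thus ?thesis by blast
  qed
qed

text \<open>Independent vectors are carried along with dual functionals: all coordinates are then given
  by explicit scalar products.\<close>

definition biorthogonal :: "nat \<Rightarrow> nat \<Rightarrow> (nat \<Rightarrow> 'a::field vec) \<Rightarrow> (nat \<Rightarrow> 'a vec) \<Rightarrow> bool" where
  "biorthogonal n s \<psi> e \<longleftrightarrow>
     (\<forall>i<s. \<psi> i \<in> carrier_vec n \<and> e i \<in> carrier_vec n) \<and>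
     (\<forall>i<s. \<forall>j<s. \<psi> i \<bullet> e j = (if i = j then 1 else 0))"

text \<open>Filling up with zero rows turns the system of \<open>s\<close> equations into a singular square one.\<close>

lemma common_kernel_nonzero:
  fixes \<psi> :: "nat \<Rightarrow> 'a::field vec"
  assumes "s < n" and \<psi>: "\<And>i. i < s \<Longrightarrow> \<psi> i \<in> carrier_vec n"
  shows "\<exists>v \<in> carrier_vec n. v \<noteq> 0\<^sub>v n \<and> (\<forall>i<s. \<psi> i \<bullet> v = 0)"
proof -
  define M where "M = mat\<^sub>r n n (\<lambda>i. if i < s then \<psi> i else 0\<^sub>v n)"
  have M: "M \<in> carrier_mat n n" by (simp add: M_def)
  have row: "row M i = (if i < s then \<psi> i else 0\<^sub>v n)" if "i < n" for i
    using that \<psi> by (simp add: M_def)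
  have "M = mat\<^sub>r n n (\<lambda>i. if i = s then 0\<^sub>v n else row M i)"
    using assms(1) by (intro eq_matI) (auto simp: M_def)
  hence "det M = 0" using det_row_0[OF assms(1), of "row M"] M by auto
  then obtain v where v: "v \<in> carrier_vec n" "v \<noteq> 0\<^sub>v n" "M *\<^sub>v v = 0\<^sub>v n"
    using det_0_iff_vec_prod_zero_field[OF M] by auto
  have "\<psi> i \<bullet> v = 0" if "i < s" for i
  proof -
    have "(M *\<^sub>v v) $ i = 0" using v(3) that assms(1) by simp
    thus ?thesis using that assms(1) M row[of i] by simp
  qed
  thus ?thesis using v by blast
qed

text \<open>A vector \<open>v\<close> killed by all \<open>\<psi> i\<close> is the next basis vector; subtracting multiples of the
  \<open>\<psi> i\<close> from a coordinate functional that is nonzero at \<open>v\<close> gives its dual.\<close>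

lemma biorthogonal_extend_one:
  assumes "biorthogonal n s \<psi> e" and "s < n"
  shows "\<exists>\<psi>' e'. biorthogonal n (Suc s) \<psi>' e' \<and> (\<forall>i<s. \<psi>' i = \<psi> i \<and> e' i = e i)"
proof -
  have c: "\<And>i. i < s \<Longrightarrow> \<psi> i \<in> carrier_vec n" "\<And>i. i < s \<Longrightarrow> e i \<in> carrier_vec n"
    and d: "\<And>i j. i < s \<Longrightarrow> j < s \<Longrightarrow> \<psi> i \<bullet> e j = (if i = j then 1 else 0)"
    using assms(1) by (auto simp: biorthogonal_def)
  obtain v where v: "v \<in> carrier_vec n" "v \<noteq> 0\<^sub>v n" and \<psi>v: "\<And>i. i < s \<Longrightarrow> \<psi> i \<bullet> v = 0"
    using common_kernel_nonzero[of s n \<psi>] assms(2) c(1) by blast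
  obtain p where p: "p < n" "v $ p \<noteq> 0"
    using v by (metis carrier_vecD eq_vecI index_zero_vec(1,2))
  define \<phi> where "\<phi> = vec n (\<lambda>t. (unit_vec n p $ t - (\<Sum>i<s. e i $ p * \<psi> i $ t)) / v $ p)"
  have \<phi>c: "\<phi> \<in> carrier_vec n" by (simp add: \<phi>_def)
  have \<phi>u: "\<phi> \<bullet> u = (u $ p - (\<Sum>i<s. e i $ p * (\<psi> i \<bullet> u))) / v $ p" if u: "u \<in> carrier_vec n" for u
  proof -
    have "\<phi> \<bullet> u = (\<Sum>t<n. (unit_vec n p $ t * u $ t - (\<Sum>i<s. e i $ p * (\<psi> i $ t * u $ t))) / v $ p)"
      using u by (auto simp: scalar_prod_def \<phi>_def atLeast0LessThan algebra_simps diff_divide_distrib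
          sum_distrib_left intro!: sum.cong)
    also have "\<dots> = ((\<Sum>t<n. unit_vec n p $ t * u $ t) - (\<Sum>i<s. e i $ p * (\<Sum>t<n. \<psi> i $ t * u $ t))) / v $ p"
      by (simp add: sum_subtractf sum_divide_distrib[symmetric] sum_distrib_left)
        (subst sum.swap, simp)
    also have "(\<Sum>t<n. unit_vec n p $ t * u $ t) = unit_vec n p \<bullet> u"
      using u by (simp add: scalar_prod_def atLeast0LessThan)
    also have "(\<Sum>i<s. e i $ p * (\<Sum>t<n. \<psi> i $ t * u $ t)) = (\<Sum>i<s. e i $ p * (\<psi> i \<bullet> u))"
      using u by (simp add: scalar_prod_def atLeast0LessThan)
    finally show ?thesis using u p(1) by simp
  qed
  have \<phi>e: "\<phi> \<bullet> e j = 0" if "j < s" for j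
  proof -
    have "(\<Sum>i<s. e i $ p * (\<psi> i \<bullet> e j)) = (\<Sum>i<s. if i = j then e i $ p else 0)"
      using that by (intro sum.cong) (auto simp: d)
    also have "\<dots> = e j $ p" using that by simp
    finally show ?thesis using \<phi>u[OF c(2)[OF that]] by simp
  qed
  have \<phi>v: "\<phi> \<bullet> v = 1" using \<phi>u[OF v(1)] \<psi>v p by simp
  have "biorthogonal n (Suc s) (\<psi>(s := \<phi>)) (e(s := v))"
    unfolding biorthogonal_def using c d v(1) \<phi>c \<phi>e \<phi>v \<psi>v by (auto simp: less_Suc_eq)
  thus ?thesis by (intro exI[of _ "\<psi>(s := \<phi>)"] exI[of _ "e(s := v)"]) auto
qed

lemma biorthogonal_extend:
  assumes "biorthogonal n s \<psi> e" and "s \<le> n"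
  shows "\<exists>\<psi>' e'. biorthogonal n n \<psi>' e' \<and> (\<forall>i<s. \<psi>' i = \<psi> i \<and> e' i = e i)"
  using assms
proof (induction "n - s" arbitrary: s \<psi> e)
  case 0
  thus ?case by auto
next
  case (Suc d)
  then obtain \<psi>' e' where 1: "biorthogonal n (Suc s) \<psi>' e'" "\<forall>i<s. \<psi>' i = \<psi> i \<and> e' i = e i"
    using biorthogonal_extend_one[of n s \<psi> e] Suc.hyps(2) by force
  obtain \<psi>'' e'' where 2: "biorthogonal n n \<psi>'' e''" "\<forall>i<Suc s. \<psi>'' i = \<psi>' i \<and> e'' i = e' i"
    using Suc.hyps(1)[OF _ 1(1)] Suc.hyps(2) by force
  show ?case
    by (intro exI[of _ \<psi>''] exI[of _ e'']) (use 1 2 in auto)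
qed

lemma biorthogonal_mono:
  assumes "biorthogonal n s \<psi> e" and "t \<le> s"
  shows "biorthogonal n t \<psi> e"
  using assms by (auto simp: biorthogonal_def)

text \<open>A square biorthogonal system consists of two matrices inverse to each other, and a
  left inverse of a square matrix is a right inverse.\<close>

lemma biorthogonal_full_inverse:
  assumes "biorthogonal n n \<psi> e"
  shows "mat_of_cols n (map e [0..<n]) * mat_of_rows n (map \<psi> [0..<n]) = 1\<^sub>m n"
proof (rule mat_mult_left_right_inverse)
  show "mat_of_rows n (map \<psi> [0..<n]) * mat_of_cols n (map e [0..<n]) = 1\<^sub>m n"
    by (rule eq_matI) (use assms in \<open>auto simp: biorthogonal_def\<close>)
qed auto

lemma biorthogonal_full_eq_zero:
  assumes "biorthogonal n n \<psi> e" and v: "v \<in> carrier_vec n"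
    and 0: "\<And>i. i < n \<Longrightarrow> \<psi> i \<bullet> v = 0"
  shows "v = 0\<^sub>v n"
proof -
  define P where "P = mat_of_cols n (map e [0..<n])"
  define Q where "Q = mat_of_rows n (map \<psi> [0..<n])"
  have P: "P \<in> carrier_mat n n" and Q: "Q \<in> carrier_mat n n" by (auto simp: P_def Q_def)
  have "Q *\<^sub>v v = 0\<^sub>v n"
    by (rule eq_vecI) (use 0 v assms(1) in \<open>auto simp: Q_def biorthogonal_def\<close>)
  hence "P *\<^sub>v (Q *\<^sub>v v) = 0\<^sub>v n" using P by (intro eq_vecI) auto
  thus ?thesis using biorthogonal_full_inverse[OF assms(1)] v assoc_mult_mat_vec[OF P Q v]
    by (simp add: P_def Q_def)
qed

lemma biorthogonal_sym: "biorthogonal n s \<psi> e \<Longrightarrow> biorthogonal n s e \<psi>"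
  by (auto simp: biorthogonal_def comm_scalar_prod[of _ n])

lemma biorthogonal_size_le:
  assumes "biorthogonal n s \<psi> e"
  shows "s \<le> n"
proof (rule ccontr)
  assume "\<not> s \<le> n"
  hence s: "n < s" by simp
  have "e n = 0\<^sub>v n"
    by (rule biorthogonal_full_eq_zero[OF biorthogonal_mono[OF assms, of n]])
      (use assms s in \<open>auto simp: biorthogonal_def\<close>)
  moreover have "\<psi> n \<bullet> e n = 1" "\<psi> n \<in> carrier_vec n" using assms s by (auto simp: biorthogonal_def)
  ultimately show False by simp
qed

section \<open>Chains in a skew-symmetric pencil\<close>

lemma skew_form:
  fixes A :: "'a::field mat"
  assumes "A \<in> carrier_mat n n" "skew_symmetric_mat A"
    and "u \<in> carrier_vec n" "v \<in> carrier_vec n"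
  shows "u \<bullet> (A *\<^sub>v v) = - (v \<bullet> (A *\<^sub>v u))"
proof -
  have "u \<bullet> (A *\<^sub>v v) = (A\<^sup>T *\<^sub>v u) \<bullet> v"
    using transpose_vec_mult_scalar[OF assms(1,4,3)] by simp
  also have "A\<^sup>T *\<^sub>v u = - (A *\<^sub>v u)" using assms by (simp add: skew_symmetric_mat_def)
  also have "- (A *\<^sub>v u) \<bullet> v = - (v \<bullet> (A *\<^sub>v u))"
    using assms by (simp add: comm_scalar_prod[of _ n])
  finally show ?thesis .
qed

lemma skew_form_self:
  fixes A :: "'a::field_char_0 mat"
  assumes "A \<in> carrier_mat n n" "skew_symmetric_mat A" "u \<in> carrier_vec n"
  shows "u \<bullet> (A *\<^sub>v u) = 0"
  using skew_form[OF assms assms(3)] by (simp add: eq_neg_iff_add_eq_0)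

text \<open>A chain lists the coefficients of a vector polynomial \<open>\<Sum>i\<le>k. t\<^sup>i x i\<close> in the kernel of
  \<open>t A - B\<close>.\<close>

definition kernel_chain :: "nat \<Rightarrow> 'a::field mat \<Rightarrow> 'a mat \<Rightarrow> nat \<Rightarrow> (nat \<Rightarrow> 'a vec) \<Rightarrow> bool" where
  "kernel_chain n A B k x \<longleftrightarrow> (\<forall>i\<le>k. x i \<in> carrier_vec n) \<and>
     B *\<^sub>v x 0 = 0\<^sub>v n \<and> (\<forall>i<k. A *\<^sub>v x i = B *\<^sub>v x (Suc i)) \<and> A *\<^sub>v x k = 0\<^sub>v n"

definition has_chain :: "nat \<Rightarrow> 'a::field mat \<Rightarrow> 'a mat \<Rightarrow> nat \<Rightarrow> bool" where
  "has_chain n A B k \<longleftrightarrow> (\<exists>x. kernel_chain n A B k x \<and> (\<exists>i\<le>k. x i \<noteq> 0\<^sub>v n))"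

text \<open>If the first vector of a nonzero chain were zero, dropping it would leave a shorter one.\<close>

lemma minimal_chain_start_nonzero:
  fixes A B :: "'a::field mat"
  assumes A: "A \<in> carrier_mat n n" and B: "B \<in> carrier_mat n n"
    and x: "kernel_chain n A B k x" "\<exists>i\<le>k. x i \<noteq> 0\<^sub>v n"
    and min: "\<And>l. l < k \<Longrightarrow> \<not> has_chain n A B l"
  shows "x 0 \<noteq> 0\<^sub>v n"
proof
  assume 0: "x 0 = 0\<^sub>v n"
  with x(2) obtain l where k: "k = Suc l" by (metis le_zero_eq not0_implies_Suc)
  have "A *\<^sub>v x 0 = B *\<^sub>v x (Suc 0)" using x(1) k by (auto simp: kernel_chain_def)
  moreover have "A *\<^sub>v 0\<^sub>v n = 0\<^sub>v n" using A by (intro eq_vecI) auto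
  ultimately have "B *\<^sub>v x (Suc 0) = 0\<^sub>v n" using 0 by simp
  hence chain: "kernel_chain n A B l (\<lambda>i. x (Suc i))"
    using x(1) by (auto simp: kernel_chain_def k)
  have "\<exists>i\<le>l. x (Suc i) \<noteq> 0\<^sub>v n" using x(2) 0 k by (metis Suc_le_mono not0_implies_Suc)
  hence "has_chain n A B l" using chain unfolding has_chain_def by (intro exI[of _ "\<lambda>i. x (Suc i)"]) auto
  thus False using min k by blast
qed

text \<open>The dual sequence solves a homogeneous linear system on which the functional
  \<open>y \<mapsto> y 0 \<bullet> A x0\<close> must not vanish.  If it did, it would be a linear combination of the
  equations, and the coefficient vectors \<open>w\<close> of that combination would continue \<open>x0\<close> to a
  chain of degree \<open>l\<close>.\<close>

lemma dual_sequence_exists: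
  fixes A B :: "'a::field mat"
  assumes A: "A \<in> carrier_mat n n" and B: "B \<in> carrier_mat n n"
    and skew: "skew_symmetric_mat A" "skew_symmetric_mat B"
    and x0: "x0 \<in> carrier_vec n" "x0 \<noteq> 0\<^sub>v n" "B *\<^sub>v x0 = 0\<^sub>v n"
    and noch: "\<not> has_chain n A B l"
  shows "\<exists>y. (\<forall>j. y j \<in> carrier_vec n) \<and> (\<forall>j<l. A *\<^sub>v y (Suc j) = B *\<^sub>v y j) \<and> y 0 \<bullet> (A *\<^sub>v x0) = 1"
proof (rule ccontr)
  assume no: "\<not> ?thesis"
  define U where "U = {y :: nat \<Rightarrow> 'a vec. \<forall>j. y j \<in> carrier_vec n}"
  define comb where "comb = (\<lambda>c (u :: nat \<Rightarrow> 'a vec) w j. u j + c \<cdot>\<^sub>v w j)"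
  define f where "f = (\<lambda>p (y :: nat \<Rightarrow> 'a vec). (A *\<^sub>v y (Suc (fst p)) - B *\<^sub>v y (fst p)) $ snd p)"
  define g where "g = (\<lambda>y :: nat \<Rightarrow> 'a vec. y 0 \<bullet> (A *\<^sub>v x0))"
  have Ax0: "A *\<^sub>v x0 \<in> carrier_vec n" using A x0 by simp
  have "\<exists>c. \<forall>u\<in>U. g u = (\<Sum>p\<in>{..<l}\<times>{..<n}. c p * f p u)"
  proof (rule functional_vanishing_on_common_kernel[where comb = comb])
    show "comb c u w \<in> U" if "u \<in> U" "w \<in> U" for c u w
      using that by (auto simp: U_def comb_def)
    show "f p (comb c u w) = f p u + c * f p w"
      if p: "p \<in> {..<l}\<times>{..<n}" and u: "u \<in> U" and w: "w \<in> U" for p c u w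
    proof -
      obtain j i where [simp]: "p = (j, i)" by (cases p)
      have c: "u j \<in> carrier_vec n" "u (Suc j) \<in> carrier_vec n"
        "w j \<in> carrier_vec n" "w (Suc j) \<in> carrier_vec n"
        using u w by (auto simp: U_def)
      have i: "i < n" using p by simp
      have "A *\<^sub>v (u (Suc j) + c \<cdot>\<^sub>v w (Suc j)) = A *\<^sub>v u (Suc j) + c \<cdot>\<^sub>v (A *\<^sub>v w (Suc j))"
        "B *\<^sub>v (u j + c \<cdot>\<^sub>v w j) = B *\<^sub>v u j + c \<cdot>\<^sub>v (B *\<^sub>v w j)"
        using A B c by (simp_all add: mult_add_distrib_mat_vec[of _ n n] mult_mat_vec[of _ n n])
      hence "f p (comb c u w) = (A *\<^sub>v u (Suc j) + c \<cdot>\<^sub>v (A *\<^sub>v w (Suc j)) - (B *\<^sub>v u j + c \<cdot>\<^sub>v (B *\<^sub>v w j))) $ i"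
        by (simp add: f_def comb_def)
      thus ?thesis using A B c i by (simp add: f_def right_diff_distrib)
    qed
    show "g (comb c u w) = g u + c * g w" if "u \<in> U" "w \<in> U" for c u w
    proof -
      have "u 0 \<in> carrier_vec n" "w 0 \<in> carrier_vec n" using that by (auto simp: U_def)
      thus ?thesis using Ax0
        by (simp add: g_def comb_def add_scalar_prod_distrib[of _ n])
    qed
    show "g y = 0" if y: "y \<in> U" and 0: "\<And>p. p \<in> {..<l}\<times>{..<n} \<Longrightarrow> f p y = 0" for y
    proof (rule ccontr)
      assume g: "g y \<noteq> 0"
      have yc: "y j \<in> carrier_vec n" for j using y by (auto simp: U_def)
      have eq: "A *\<^sub>v y (Suc j) = B *\<^sub>v y j" if "j < l" for j
      proof (rule eq_vecI)
        fix i assume "i < dim_vec (B *\<^sub>v y j)"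
        hence i: "i < n" using B by simp
        show "(A *\<^sub>v y (Suc j)) $ i = (B *\<^sub>v y j) $ i"
          using 0[of "(j, i)"] that i A B yc by (simp add: f_def)
      qed (use A B in simp)
      define y' where "y' = (\<lambda>j. inverse (g y) \<cdot>\<^sub>v y j)"
      have "\<forall>j. y' j \<in> carrier_vec n" using yc by (simp add: y'_def)
      moreover have "\<forall>j<l. A *\<^sub>v y' (Suc j) = B *\<^sub>v y' j"
        using eq A B yc by (simp add: y'_def mult_mat_vec[of _ n n])
      moreover have "y' 0 \<bullet> (A *\<^sub>v x0) = 1"
        using g yc[of 0] Ax0 by (simp add: y'_def g_def)
      ultimately show False using no by blast
    qed
  qed simp
  then obtain c where c: "\<And>u. u \<in> U \<Longrightarrow> g u = (\<Sum>p\<in>{..<l}\<times>{..<n}. c p * f p u)" by blast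
  define w where "w j = vec n (\<lambda>i. c (j, i))" for j
  have wc: "w j \<in> carrier_vec n" for j by (simp add: w_def)
  have g: "g y = (\<Sum>j<l. y j \<bullet> (B *\<^sub>v w j) - y (Suc j) \<bullet> (A *\<^sub>v w j))" if y: "y \<in> U" for y
  proof -
    have yc: "y j \<in> carrier_vec n" for j using y by (auto simp: U_def)
    have "g y = (\<Sum>j<l. w j \<bullet> (A *\<^sub>v y (Suc j) - B *\<^sub>v y j))"
      unfolding c[OF y] sum.cartesian_product'
      using A B by (intro sum.cong) (auto simp: scalar_prod_def f_def w_def atLeast0LessThan)
    also have "\<dots> = (\<Sum>j<l. y j \<bullet> (B *\<^sub>v w j) - y (Suc j) \<bullet> (A *\<^sub>v w j))"
    proof (rule sum.cong[OF refl])
      fix j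
      have "w j \<bullet> (A *\<^sub>v y (Suc j) - B *\<^sub>v y j) = w j \<bullet> (A *\<^sub>v y (Suc j)) - w j \<bullet> (B *\<^sub>v y j)"
        using A B wc yc by (intro scalar_prod_minus_distrib[of _ n]) auto
      thus "w j \<bullet> (A *\<^sub>v y (Suc j) - B *\<^sub>v y j) = y j \<bullet> (B *\<^sub>v w j) - y (Suc j) \<bullet> (A *\<^sub>v w j)"
        using skew_form[OF A skew(1) wc yc, of j "Suc j"] skew_form[OF B skew(2) wc yc, of j j]
        by simp
    qed
    finally show ?thesis .
  qed
  \<comment> \<open>Testing the identity on sequences with a single nonzero entry \<open>u\<close>, at place \<open>m\<close>.\<close>
  have spike: "(if m = 0 then u \<bullet> (A *\<^sub>v x0) else 0) =
      (if m < l then u \<bullet> (B *\<^sub>v w m) else 0) - (if 0 < m \<and> m \<le> l then u \<bullet> (A *\<^sub>v w (m - 1)) else 0)"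
    if u: "u \<in> carrier_vec n" for u m
  proof -
    define y where "y j = (if j = m then u else 0\<^sub>v n)" for j
    have yU: "y \<in> U" using u by (auto simp: U_def y_def)
    have cB: "B *\<^sub>v w j \<in> carrier_vec n" and cA: "A *\<^sub>v w j \<in> carrier_vec n" for j
      using A B wc by auto
    have "(\<Sum>j<l. y j \<bullet> (B *\<^sub>v w j)) = (\<Sum>j<l. if j = m then u \<bullet> (B *\<^sub>v w m) else 0)"
      by (intro sum.cong) (auto simp: y_def scalar_prod_left_zero[OF cB])
    hence 1: "(\<Sum>j<l. y j \<bullet> (B *\<^sub>v w j)) = (if m < l then u \<bullet> (B *\<^sub>v w m) else 0)" by simp
    have "(\<Sum>j<l. y (Suc j) \<bullet> (A *\<^sub>v w j)) = (\<Sum>j<l. if 0 < m \<and> j = m - 1 then u \<bullet> (A *\<^sub>v w (m - 1)) else 0)"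
      by (intro sum.cong) (auto simp: y_def scalar_prod_left_zero[OF cA])
    also have "\<dots> = (if 0 < m \<and> m \<le> l then u \<bullet> (A *\<^sub>v w (m - 1)) else 0)"
      by (cases m) auto
    finally have 2: "(\<Sum>j<l. y (Suc j) \<bullet> (A *\<^sub>v w j)) = \<dots>" .
    have "g y = (if m = 0 then u \<bullet> (A *\<^sub>v x0) else 0)"
      using scalar_prod_left_zero[OF Ax0] by (auto simp: g_def y_def)
    thus ?thesis using g[OF yU] 1 2 by (simp add: sum_subtractf)
  qed
  define x' where "x' i = (case i of 0 \<Rightarrow> x0 | Suc j \<Rightarrow> w j)" for i
  have x'c: "x' i \<in> carrier_vec n" for i using x0 wc by (auto simp: x'_def split: nat.split)
  have step: "A *\<^sub>v x' m = B *\<^sub>v x' (Suc m)" if "m < l" for m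
  proof (rule vec_eq_if_scalar_prods_eq[of _ n])
    fix u :: "'a vec" assume "u \<in> carrier_vec n"
    thus "u \<bullet> (A *\<^sub>v x' m) = u \<bullet> (B *\<^sub>v x' (Suc m))"
      using spike[of u m] that by (cases m) (auto simp: x'_def)
  qed (use A B x'c in auto)
  have last: "A *\<^sub>v x' l = 0\<^sub>v n"
  proof (rule vec_eq_if_scalar_prods_eq[of _ n])
    fix u :: "'a vec" assume "u \<in> carrier_vec n"
    thus "u \<bullet> (A *\<^sub>v x' l) = u \<bullet> 0\<^sub>v n"
      using spike[of u l] by (cases l) (auto simp: x'_def)
  qed (use A x'c in auto)
  have "kernel_chain n A B l x'"
    unfolding kernel_chain_def using x'c step last x0 by (auto simp: x'_def)
  hence "has_chain n A B l" unfolding has_chain_def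
    using x0 by (intro exI[of _ x']) (auto simp: x'_def intro!: exI[of _ 0])
  thus False using noch by blast
qed

text \<open>The step equations turn \<open>B\<close> into \<open>A\<close> with a shifted index, and skew symmetry lets both arguments
  be shifted.  Hence \<open>y j \<bullet> A x i\<close> depends on \<open>i - j\<close> only, and \<open>x i \<bullet> A x j\<close> and \<open>y i \<bullet> A y j\<close> depend on
  \<open>i + j\<close> only.  The first is zero for \<open>i \<noteq> j\<close> and the second is zero because both can be shifted to an
  end of the chain; the third is symmetric in \<open>i\<close> and \<open>j\<close> as well as skew, hence zero.\<close>

locale dual_chain =
  fixes n :: nat and A B :: "'a::field_char_0 mat" and k :: nat and x y :: "nat \<Rightarrow> 'a vec"
  assumes A: "A \<in> carrier_mat n n" and B: "B \<in> carrier_mat n n"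
    and skew_A: "skew_symmetric_mat A" and skew_B: "skew_symmetric_mat B"
    and k: "0 < k"
    and chain: "kernel_chain n A B k x"
    and y_carrier: "\<And>j. y j \<in> carrier_vec n"
    and y_step: "\<And>j. Suc j < k \<Longrightarrow> A *\<^sub>v y (Suc j) = B *\<^sub>v y j"
    and norm: "y 0 \<bullet> (A *\<^sub>v x 0) = 1"
begin

lemma x_carrier: "i \<le> k \<Longrightarrow> x i \<in> carrier_vec n"
  and B_x0: "B *\<^sub>v x 0 = 0\<^sub>v n"
  and x_step: "i < k \<Longrightarrow> A *\<^sub>v x i = B *\<^sub>v x (Suc i)"
  and A_xk: "A *\<^sub>v x k = 0\<^sub>v n"
  using chain by (auto simp: kernel_chain_def)

lemmas swap_A = skew_form[OF A skew_A]
lemmas swap_B = skew_form[OF B skew_B]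

lemma yAx_shift:
  assumes "i < k" "Suc j < k"
  shows "y (Suc j) \<bullet> (A *\<^sub>v x (Suc i)) = y j \<bullet> (A *\<^sub>v x i)"
proof -
  have "y (Suc j) \<bullet> (A *\<^sub>v x (Suc i)) = - (x (Suc i) \<bullet> (B *\<^sub>v y j))"
    using swap_A[OF y_carrier x_carrier, of "Suc i" "Suc j"] y_step assms by simp
  also have "\<dots> = y j \<bullet> (B *\<^sub>v x (Suc i))" using swap_B[OF y_carrier x_carrier, of "Suc i" j] assms by simp
  finally show ?thesis using x_step assms by simp
qed

lemma yAx_shift_many:
  assumes "i + d \<le> k" "j + d < k"
  shows "y (j + d) \<bullet> (A *\<^sub>v x (i + d)) = y j \<bullet> (A *\<^sub>v x i)"
  using assms by (induction d) (auto simp: yAx_shift)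

lemma yAx:
  assumes i: "i \<le> k" and j: "j < k"
  shows "y j \<bullet> (A *\<^sub>v x i) = (if i = j then 1 else 0)"
proof -
  consider "i = j" | "j < i" | "i < j" by linarith
  thus ?thesis
  proof cases
    case 1
    thus ?thesis using yAx_shift_many[of 0 i 0] norm i j by simp
  next
    case 2
    have "y (j + (k - i)) \<bullet> (A *\<^sub>v x (i + (k - i))) = y j \<bullet> (A *\<^sub>v x i)"
      by (rule yAx_shift_many) (use 2 i in auto)
    thus ?thesis using 2 i A_xk y_carrier by simp
  next
    case 3
    then obtain m where m: "j = i + Suc m" using less_iff_Suc_add by auto
    have "y j \<bullet> (A *\<^sub>v x i) = y (Suc m) \<bullet> (A *\<^sub>v x 0)"
      using yAx_shift_many[of 0 i "Suc m"] m j by (simp add: add.commute)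
    also have "\<dots> = - (x 0 \<bullet> (B *\<^sub>v y m))"
      using swap_A[OF y_carrier x_carrier, of 0 "Suc m"] y_step[of m] m j by simp
    also have "\<dots> = y m \<bullet> (B *\<^sub>v x 0)" using swap_B[OF y_carrier x_carrier, of 0 m] by simp
    also have "\<dots> = 0" using B_x0 y_carrier by simp
    finally show ?thesis using 3 by simp
  qed
qed

lemma yBx:
  assumes "i \<le> k" "j < k"
  shows "y j \<bullet> (B *\<^sub>v x i) = (if i = Suc j then 1 else 0)"
proof (cases i)
  case 0
  thus ?thesis using B_x0 y_carrier by simp
next
  case (Suc m)
  thus ?thesis using yAx[of m j] x_step[of m] assms by simp
qed

lemma xAx:
  assumes "i \<le> k" "j \<le> k"
  shows "x i \<bullet> (A *\<^sub>v x j) = 0"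
  using assms
proof (induction i arbitrary: j)
  case 0
  show ?case
  proof (cases "j = k")
    case True
    thus ?thesis using A_xk x_carrier by simp
  next
    case False
    hence "x 0 \<bullet> (A *\<^sub>v x j) = - (x (Suc j) \<bullet> (B *\<^sub>v x 0))"
      using swap_B[OF x_carrier x_carrier, of 0 "Suc j"] x_step 0 by simp
    thus ?thesis using B_x0 x_carrier[of "Suc j"] False 0 by simp
  qed
next
  case (Suc i)
  show ?case
  proof (cases "j = k")
    case True
    thus ?thesis using A_xk x_carrier[of "Suc i"] Suc.prems by simp
  next
    case False
    hence "x (Suc i) \<bullet> (A *\<^sub>v x j) = - (x (Suc j) \<bullet> (A *\<^sub>v x i))"
      using swap_B[OF x_carrier x_carrier, of "Suc i" "Suc j"] x_step Suc.prems by simp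
    also have "\<dots> = x i \<bullet> (A *\<^sub>v x (Suc j))" using swap_A[OF x_carrier x_carrier, of i "Suc j"] Suc.prems False by simp
    finally show ?thesis using Suc.IH[of "Suc j"] Suc.prems False by simp
  qed
qed

lemma xBx:
  assumes "i \<le> k" "j \<le> k"
  shows "x i \<bullet> (B *\<^sub>v x j) = 0"
  using assms xAx[of i "j - 1"] x_step[of "j - 1"] B_x0 x_carrier by (cases j) auto

lemma yAy_shift:
  assumes "i + d < k"
    and "e \<le> d"
  shows "y (i + e) \<bullet> (A *\<^sub>v y (i + (d - e))) = y i \<bullet> (A *\<^sub>v y (i + d))"
  using assms(2)
proof (induction e)
  case (Suc e)
  define j where "j = i + (d - Suc e)"
  have j: "i + (d - e) = Suc j" "j < k" "Suc j < k" "Suc (i + e) < k"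
    using Suc.prems assms(1) by (auto simp: j_def)
  have "y (i + e) \<bullet> (A *\<^sub>v y (Suc j)) = y (i + e) \<bullet> (B *\<^sub>v y j)" using y_step j by simp
  also have "\<dots> = - (y j \<bullet> (B *\<^sub>v y (i + e)))" using swap_B[OF y_carrier y_carrier] .
  also have "\<dots> = - (y j \<bullet> (A *\<^sub>v y (Suc (i + e))))" using y_step j by simp
  also have "\<dots> = y (Suc (i + e)) \<bullet> (A *\<^sub>v y j)" using swap_A[OF y_carrier y_carrier, of "Suc (i + e)" j] by simp
  finally show ?case using Suc j by (simp add: j_def)
qed simp

lemma yAy:
  assumes "i < k" "j < k"
  shows "y i \<bullet> (A *\<^sub>v y j) = 0"
proof -
  have le: "y i \<bullet> (A *\<^sub>v y (i + d)) = 0" if "i + d < k" for i d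
  proof -
    have "y (i + d) \<bullet> (A *\<^sub>v y i) = y i \<bullet> (A *\<^sub>v y (i + d))" using yAy_shift[OF that, of d] by simp
    thus ?thesis using swap_A[OF y_carrier y_carrier, of i "i + d"] by (simp add: eq_neg_iff_add_eq_0)
  qed
  show ?thesis
  proof (cases "i \<le> j")
    case True
    thus ?thesis using le[of i "j - i"] assms by simp
  next
    case False
    thus ?thesis using le[of j "i - j"] assms swap_A[OF y_carrier y_carrier, of i j] by simp
  qed
qed

lemma yBy:
  assumes "i < k" "j < k"
  shows "y i \<bullet> (B *\<^sub>v y j) = 0"
proof -
  consider "Suc j < k" | "Suc i < k" | "i = j" using assms by linarith
  thus ?thesis
  proof cases
    case 1
    thus ?thesis using yAy[of i "Suc j"] y_step assms by simp
  next
    case 2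
    thus ?thesis using yAy[of j "Suc i"] y_step[of i] swap_B[OF y_carrier y_carrier, of i j] assms by simp
  next
    case 3
    thus ?thesis using skew_form_self[OF B skew_B y_carrier] by simp
  qed
qed

end

section \<open>Constant kernel dimension forces a chain\<close>

text \<open>As a polynomial in \<open>t\<close> the determinant has infinitely many zeros, so it is zero and the
  matrix \<open>t A - B\<close> over the polynomial ring kills a nonzero vector.  The coefficients of that
  vector, up to the largest degree of its entries, are the chain.\<close>

lemma has_chain_if_pencil_singular:
  fixes A B :: "'a::field_char_0 mat"
  assumes A: "A \<in> carrier_mat n n" and B: "B \<in> carrier_mat n n"
    and sing: "\<And>t. det (t \<cdot>\<^sub>m A - B) = 0"
  shows "\<exists>k. has_chain n A B k"
proof -
  define M where "M = mat n n (\<lambda>(i, j). [:- B $$ (i, j), A $$ (i, j):])"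
  have M: "M \<in> carrier_mat n n" by (simp add: M_def)
  have "poly (det M) t = 0" for t
  proof -
    have hom: "comm_ring_hom (\<lambda>p :: 'a poly. poly p t)" by unfold_locales auto
    have "map_mat (\<lambda>p. poly p t) M = t \<cdot>\<^sub>m A - B"
      using A B by (intro eq_matI) (auto simp: M_def)
    thus ?thesis using sing[of t] comm_ring_hom.hom_det[OF hom, of M] by simp
  qed
  hence "det M = 0" using poly_all_0_iff_0 by blast
  then obtain v where v: "v \<in> carrier_vec n" "v \<noteq> 0\<^sub>v n" "M *\<^sub>v v = 0\<^sub>v n"
    using det_0_iff_vec_prod_zero[OF M] by auto
  define x where "x i = vec n (\<lambda>r. coeff (v $ r) i)" for i
  have row: "(\<Sum>c<n. Polynomial.smult (- B $$ (r, c)) (v $ c) + pCons 0 (Polynomial.smult (A $$ (r, c)) (v $ c))) = 0"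
    if r: "r < n" for r
  proof -
    have "(M *\<^sub>v v) $ r = (\<Sum>c<n. Polynomial.smult (- B $$ (r, c)) (v $ c) + pCons 0 (Polynomial.smult (A $$ (r, c)) (v $ c)))"
      using r v(1) by (auto simp: M_def scalar_prod_def atLeast0LessThan intro!: sum.cong)
    thus ?thesis using v(3) r by simp
  qed
  have cB: "(\<Sum>c<n. B $$ (r, c) * coeff (v $ c) i) = (B *\<^sub>v x i) $ r"
    and cA: "(\<Sum>c<n. A $$ (r, c) * coeff (v $ c) i) = (A *\<^sub>v x i) $ r" if "r < n" for r i
    using that A B by (auto simp: x_def scalar_prod_def atLeast0LessThan)
  have B0: "B *\<^sub>v x 0 = 0\<^sub>v n"
  proof (rule eq_vecI)
    fix r assume "r < dim_vec (0\<^sub>v n :: 'a vec)"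
    hence r: "r < n" by simp
    show "(B *\<^sub>v x 0) $ r = 0\<^sub>v n $ r"
      using arg_cong[OF row[OF r], of "\<lambda>p. coeff p 0"] r
      by (simp add: coeff_sum sum_negf cB[OF r, symmetric])
  qed (use B in simp)
  have step: "A *\<^sub>v x i = B *\<^sub>v x (Suc i)" for i
  proof (rule eq_vecI)
    fix r assume "r < dim_vec (B *\<^sub>v x (Suc i))"
    hence r: "r < n" using B by simp
    show "(A *\<^sub>v x i) $ r = (B *\<^sub>v x (Suc i)) $ r"
      using arg_cong[OF row[OF r], of "\<lambda>p. coeff p (Suc i)"]
      by (simp add: coeff_sum sum_subtractf cA[OF r, symmetric] cB[OF r, symmetric])
  qed (use A B in simp)
  define k where "k = Max (insert 0 ((\<lambda>r. degree (v $ r)) ` {..<n}))"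
  have deg: "degree (v $ r) \<le> k" if "r < n" for r
    unfolding k_def using that by (intro Max_ge) auto
  have "x (Suc k) = 0\<^sub>v n"
    by (rule eq_vecI) (use deg in \<open>auto simp: x_def intro!: coeff_eq_0 le_imp_less_Suc\<close>)
  moreover have "B *\<^sub>v 0\<^sub>v n = 0\<^sub>v n" using B by (intro eq_vecI) auto
  ultimately have "A *\<^sub>v x k = 0\<^sub>v n" using step[of k] by simp
  hence chain: "kernel_chain n A B k x"
    unfolding kernel_chain_def using B0 step by (auto simp: x_def)
  obtain r where r: "r < n" "v $ r \<noteq> 0"
    using v(1,2) by (metis carrier_vecD eq_vecI index_zero_vec(1,2))
  hence "x (degree (v $ r)) $ r \<noteq> 0" by (simp add: x_def)
  hence "x (degree (v $ r)) \<noteq> 0\<^sub>v n" using r by auto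
  thus ?thesis unfolding has_chain_def using chain deg[OF r(1)] by blast
qed

lemma kernel_dim_eq_0_iff:
  fixes M :: "'a::field mat"
  assumes M: "M \<in> carrier_mat n n"
  shows "kernel_dim M = 0 \<longleftrightarrow> det M \<noteq> 0"
proof -
  interpret K: kernel n n M by unfold_locales (rule M)
  have "mat_kernel M = {0\<^sub>v n} \<longleftrightarrow> det M \<noteq> 0"
    unfolding det_0_iff_vec_prod_zero_field[OF M] mat_kernel[OF M]
    using M by auto
  moreover have "K.dim = 0 \<longleftrightarrow> mat_kernel M = {0\<^sub>v n}"
  proof
    assume 0: "K.dim = 0"
    obtain bs where bs: "finite bs" "K.basis bs" using kernel_basis_exists[OF M] by blast
    hence "bs = {}" using K.Ker.dim_basis[OF bs] 0 by simp
    thus "mat_kernel M = {0\<^sub>v n}" using bs(2) K.Ker.span_empty unfolding K.Ker.basis_def by simp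
  next
    assume "mat_kernel M = {0\<^sub>v n}"
    hence "K.gen_set {}" using K.Ker.span_empty by simp
    thus "K.dim = 0" using K.Ker.gen_ge_dim[of "{}"] by simp
  qed
  ultimately show ?thesis by simp
qed

text \<open>If some member of the pencil were invertible, all of them would be; but for invertible
  \<open>A\<close> an eigenvalue \<open>t\<close> of \<open>A\<^sup>-\<^sup>1 B\<close> makes \<open>t A - B\<close> singular.\<close>

lemma pencil_singular_if_kernel_dim_constant:
  fixes A B :: "'a::alg_closed_field mat"
  assumes A: "A \<in> carrier_mat n n" and B: "B \<in> carrier_mat n n" and n: "0 < n"
    and const: "\<And>a b. (a, b) \<noteq> (0, 0) \<Longrightarrow> kernel_dim (a \<cdot>\<^sub>m A + b \<cdot>\<^sub>m B) = h"
  shows "det (t \<cdot>\<^sub>m A - B) = 0"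
proof -
  have minus: "s \<cdot>\<^sub>m A - B = s \<cdot>\<^sub>m A + (- 1) \<cdot>\<^sub>m B" for s
    using A B by (intro eq_matI) auto
  have c: "s \<cdot>\<^sub>m A - B \<in> carrier_mat n n" for s using B by (rule minus_carrier_mat)
  have dim: "kernel_dim (s \<cdot>\<^sub>m A - B) = h" for s
    unfolding minus by (rule const) simp
  have "h \<noteq> 0"
  proof
    assume 0: "h = 0"
    have "1 \<cdot>\<^sub>m A + 0 \<cdot>\<^sub>m B = A" using A B by (intro eq_matI) auto
    hence "det A \<noteq> 0" using const[of 1 0] 0 kernel_dim_eq_0_iff[OF A] by simp
    then obtain C where C: "C \<in> carrier_mat n n" and AC: "A * C = 1\<^sub>m n"
      using det_non_zero_imp_unit[OF A, unfolded Units_def, of "()"] by (auto simp: ring_mat_def)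
    have CB: "C * B \<in> carrier_mat n n" using B C by simp
    have "degree (char_poly (C * B)) = n" using degree_monic_char_poly[OF CB] by simp
    hence "\<exists>s. poly (char_poly (C * B)) s = 0"
      by (intro alg_closed_imp_poly_has_root) (simp add: n)
    then obtain s where "eigenvalue (C * B) s" using eigenvalue_root_char_poly[OF CB] by blast
    then obtain v where v: "v \<in> carrier_vec n" "v \<noteq> 0\<^sub>v n" "(C * B) *\<^sub>v v = s \<cdot>\<^sub>v v"
      using C unfolding eigenvalue_def eigenvector_def by auto
    have "B *\<^sub>v v = (A * C) *\<^sub>v (B *\<^sub>v v)" using AC B v by simp
    also have "\<dots> = A *\<^sub>v ((C * B) *\<^sub>v v)" using A B C v(1) by (simp add: assoc_mult_mat_vec[of _ n n])
    also have "\<dots> = s \<cdot>\<^sub>v (A *\<^sub>v v)" using v A by (simp add: mult_mat_vec)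
    finally have "(s \<cdot>\<^sub>m A - B) *\<^sub>v v = 0\<^sub>v n"
      using A B v(1) by (simp add: minus_mult_distrib_mat_vec[of _ n n] smult_mat_mult_vec[of _ n n])
    hence "det (s \<cdot>\<^sub>m A - B) = 0" using det_0_iff_vec_prod_zero_field[OF c] v by blast
    thus False using kernel_dim_eq_0_iff[OF c[of s]] dim[of s] 0 by simp
  qed
  thus ?thesis using kernel_dim_eq_0_iff[OF c[of t]] dim[of t] by simp
qed

section \<open>Gram matrices\<close>

definition gram :: "'a::comm_ring_1 mat \<Rightarrow> 'a vec list \<Rightarrow> 'a vec list \<Rightarrow> 'a mat" where
  "gram M us vs = mat (length us) (length vs) (\<lambda>(i, j). us ! i \<bullet> (M *\<^sub>v vs ! j))"

lemma gram_carrier [simp]: "gram M us vs \<in> carrier_mat (length us) (length vs)"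
  by (simp add: gram_def)

lemma gram_append:
  "gram M (us @ us') (vs @ vs') =
     four_block_mat (gram M us vs) (gram M us vs') (gram M us' vs) (gram M us' vs')"
  by (rule eq_matI) (auto simp: gram_def nth_append)

lemma gram_eq_mult:
  assumes M: "M \<in> carrier_mat n n" and us: "set us \<subseteq> carrier_vec n" and vs: "set vs \<subseteq> carrier_vec n"
  shows "gram M us vs = (mat_of_cols n us)\<^sup>T * M * mat_of_cols n vs"
proof (rule eq_matI)
  fix i j
  assume "i < dim_row ((mat_of_cols n us)\<^sup>T * M * mat_of_cols n vs)"
    "j < dim_col ((mat_of_cols n us)\<^sup>T * M * mat_of_cols n vs)"
  hence i: "i < length us" and j: "j < length vs" by auto
  have ui: "us ! i \<in> carrier_vec n" and vj: "vs ! j \<in> carrier_vec n"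
    using i j us vs nth_mem by blast+
  have "((mat_of_cols n us)\<^sup>T * M * mat_of_cols n vs) = (mat_of_cols n us)\<^sup>T * (M * mat_of_cols n vs)"
    using M by (intro assoc_mult_mat[of _ "length us" n _ n _ "length vs"]) auto
  thus "gram M us vs $$ (i, j) = ((mat_of_cols n us)\<^sup>T * M * mat_of_cols n vs) $$ (i, j)"
    using i j M ui vj by (simp add: gram_def col_mult2[of M n n _ "length vs"])
qed (auto simp: gram_def)

lemma gram_mult_vec:
  assumes M: "M \<in> carrier_mat n n" and us: "set us \<subseteq> carrier_vec n" and zs: "set zs \<subseteq> carrier_vec n"
    and v: "v \<in> carrier_vec (length zs)" and i: "i < length us"
  shows "(gram M us zs *\<^sub>v v) $ i = us ! i \<bullet> (M *\<^sub>v (mat_of_cols n zs *\<^sub>v v))"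
proof -
  have ui: "us ! i \<in> carrier_vec n" using i us nth_mem by blast
  define U where "U = (mat_of_cols n us)\<^sup>T"
  define Z where "Z = mat_of_cols n zs"
  have U: "U \<in> carrier_mat (length us) n" and Z: "Z \<in> carrier_mat n (length zs)"
    by (auto simp: U_def Z_def)
  have "gram M us zs *\<^sub>v v = (U * M * Z) *\<^sub>v v"
    using gram_eq_mult[OF M us zs] by (simp add: U_def Z_def)
  also have "\<dots> = U *\<^sub>v (M *\<^sub>v (Z *\<^sub>v v))"
    using assoc_mult_mat_vec[OF mult_carrier_mat[OF U M] Z v]
      assoc_mult_mat_vec[OF U M mult_mat_vec_carrier[OF Z v]] by simp
  finally have "gram M us zs *\<^sub>v v = U *\<^sub>v (M *\<^sub>v (Z *\<^sub>v v))" .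
  thus ?thesis using i ui by (simp add: U_def Z_def)
qed

lemma mat_of_cols_map_mult:
  assumes Z: "Z \<in> carrier_mat n m" and vs: "set vs \<subseteq> carrier_vec m"
  shows "mat_of_cols n (map ((*\<^sub>v) Z) vs) = Z * mat_of_cols m vs"
proof (rule eq_matI)
  fix i j assume "i < dim_row (Z * mat_of_cols m vs)" "j < dim_col (Z * mat_of_cols m vs)"
  hence i: "i < n" and j: "j < length vs" using Z by auto
  have "vs ! j \<in> carrier_vec m" using j vs nth_mem by blast
  thus "mat_of_cols n (map ((*\<^sub>v) Z) vs) $$ (i, j) = (Z * mat_of_cols m vs) $$ (i, j)"
    using i j Z by (simp add: mat_of_cols_index)
qed (use Z in auto)

lemma map_mult_carrier:
  assumes "Z \<in> carrier_mat n m" "set us \<subseteq> carrier_vec m"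
  shows "set (map ((*\<^sub>v) Z) us) \<subseteq> carrier_vec n"
  using assms by auto

text \<open>The matrix with columns \<open>zs\<close> turns coordinate vectors into vectors of the span of \<open>zs\<close>; on coordinates
  the form is given by the Gram matrix of \<open>zs\<close>.\<close>

lemma gram_map_left:
  assumes M: "M \<in> carrier_mat n n" and zs: "set zs \<subseteq> carrier_vec n" and ws: "set ws \<subseteq> carrier_vec n"
    and us: "set us \<subseteq> carrier_vec (length zs)"
  shows "gram M (map ((*\<^sub>v) (mat_of_cols n zs)) us) ws = (mat_of_cols (length zs) us)\<^sup>T * gram M zs ws"
proof -
  define Z U W where "Z = mat_of_cols n zs" and "U = mat_of_cols (length zs) us" and "W = mat_of_cols n ws"
  have c: "Z \<in> carrier_mat n (length zs)" "U \<in> carrier_mat (length zs) (length us)" "W \<in> carrier_mat n (length ws)"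
    by (auto simp: Z_def U_def W_def)
  have "gram M (map ((*\<^sub>v) Z) us) ws = (Z * U)\<^sup>T * M * W"
    using gram_eq_mult[OF M map_mult_carrier[OF c(1) us] ws] mat_of_cols_map_mult[OF c(1) us]
    by (simp add: U_def W_def)
  also have "(Z * U)\<^sup>T = U\<^sup>T * Z\<^sup>T" by (rule transpose_mult[OF c(1,2)])
  also have "U\<^sup>T * Z\<^sup>T * M * W = U\<^sup>T * (Z\<^sup>T * M * W)"
  proof -
    have T: "U\<^sup>T \<in> carrier_mat (length us) (length zs)" "Z\<^sup>T \<in> carrier_mat (length zs) n" using c by auto
    have "U\<^sup>T * Z\<^sup>T * M = U\<^sup>T * (Z\<^sup>T * M)" by (rule assoc_mult_mat[OF T M])
    moreover have "U\<^sup>T * (Z\<^sup>T * M) * W = U\<^sup>T * (Z\<^sup>T * M * W)"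
      by (rule assoc_mult_mat[OF T(1) _ c(3)]) (use T M in auto)
    ultimately show ?thesis by simp
  qed
  finally show ?thesis unfolding gram_eq_mult[OF M zs ws] by (simp add: Z_def U_def W_def)
qed

lemma gram_map_right:
  assumes M: "M \<in> carrier_mat n n" and zs: "set zs \<subseteq> carrier_vec n" and ws: "set ws \<subseteq> carrier_vec n"
    and us: "set us \<subseteq> carrier_vec (length zs)"
  shows "gram M ws (map ((*\<^sub>v) (mat_of_cols n zs)) us) = gram M ws zs * mat_of_cols (length zs) us"
proof -
  define Z U W where "Z = mat_of_cols n zs" and "U = mat_of_cols (length zs) us" and "W = (mat_of_cols n ws)\<^sup>T"
  have c: "Z \<in> carrier_mat n (length zs)" "U \<in> carrier_mat (length zs) (length us)" "W \<in> carrier_mat (length ws) n"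
    by (auto simp: Z_def U_def W_def)
  have "gram M ws (map ((*\<^sub>v) Z) us) = W * M * (Z * U)"
    using gram_eq_mult[OF M ws map_mult_carrier[OF c(1) us]] mat_of_cols_map_mult[OF c(1) us]
    by (simp add: U_def W_def)
  also have "\<dots> = W * M * Z * U"
    by (rule assoc_mult_mat[symmetric, OF _ c(1,2)]) (use c M in auto)
  finally show ?thesis unfolding gram_eq_mult[OF M ws zs] by (simp add: Z_def U_def W_def)
qed

lemma gram_map_both:
  assumes M: "M \<in> carrier_mat n n" and zs: "set zs \<subseteq> carrier_vec n" and zs': "set zs' \<subseteq> carrier_vec n"
    and us: "set us \<subseteq> carrier_vec m" and vs: "set vs \<subseteq> carrier_vec m"
    and len: "length zs = m" "length zs' = m"
  shows "gram M (map ((*\<^sub>v) (mat_of_cols n zs)) us) (map ((*\<^sub>v) (mat_of_cols n zs')) vs) =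
    gram (gram M zs zs') us vs"
proof -
  have G: "gram M zs zs' \<in> carrier_mat m m" using gram_carrier[of M zs zs'] by (simp add: len)
  have c: "mat_of_cols n zs' \<in> carrier_mat n m" using len by auto
  have "gram M (map ((*\<^sub>v) (mat_of_cols n zs)) us) (map ((*\<^sub>v) (mat_of_cols n zs')) vs) =
      (mat_of_cols m us)\<^sup>T * gram M zs (map ((*\<^sub>v) (mat_of_cols n zs')) vs)"
    using gram_map_left[OF M zs map_mult_carrier[OF c vs], of us] us len by simp
  also have "\<dots> = (mat_of_cols m us)\<^sup>T * (gram M zs zs' * mat_of_cols m vs)"
    using gram_map_right[OF M zs' zs, of vs] vs len by simp
  also have "\<dots> = (mat_of_cols m us)\<^sup>T * gram M zs zs' * mat_of_cols m vs"
    by (rule assoc_mult_mat[symmetric, OF _ G]) auto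
  finally show ?thesis unfolding gram_eq_mult[OF G us vs] .
qed

lemma gram_skew_transpose:
  fixes M :: "'a::field mat"
  assumes "M \<in> carrier_mat n n" "skew_symmetric_mat M"
    and us: "set us \<subseteq> carrier_vec n" and vs: "set vs \<subseteq> carrier_vec n"
  shows "gram M vs us = - (gram M us vs)\<^sup>T"
proof (rule eq_matI)
  fix i j assume "i < dim_row (- (gram M us vs)\<^sup>T)" "j < dim_col (- (gram M us vs)\<^sup>T)"
  hence i: "i < length vs" and j: "j < length us" by (auto simp: gram_def)
  have "us ! j \<in> carrier_vec n" "vs ! i \<in> carrier_vec n" using i j us vs nth_mem by blast+
  thus "gram M vs us $$ (i, j) = (- (gram M us vs)\<^sup>T) $$ (i, j)"
    using skew_form[OF assms(1,2), of "vs ! i" "us ! j"] i j by (simp add: gram_def)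
qed (auto simp: gram_def)

lemma gram_skew_symmetric:
  fixes M :: "'a::field mat"
  assumes M: "M \<in> carrier_mat n n" "skew_symmetric_mat M" and us: "set us \<subseteq> carrier_vec n"
  shows "skew_symmetric_mat (gram M us us)"
proof -
  have "gram M us us = - (gram M us us)\<^sup>T" by (rule gram_skew_transpose[OF M us us])
  thus ?thesis unfolding skew_symmetric_mat_def by (metis uminus_uminus_mat)
qed

lemma gram_pencil:
  fixes A B :: "'a::field mat"
  assumes A: "A \<in> carrier_mat n n" and B: "B \<in> carrier_mat n n"
    and us: "set us \<subseteq> carrier_vec n" and vs: "set vs \<subseteq> carrier_vec n"
  shows "gram (a \<cdot>\<^sub>m A + b \<cdot>\<^sub>m B) us vs = a \<cdot>\<^sub>m gram A us vs + b \<cdot>\<^sub>m gram B us vs"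
proof (rule eq_matI)
  fix i j assume "i < dim_row (a \<cdot>\<^sub>m gram A us vs + b \<cdot>\<^sub>m gram B us vs)"
    "j < dim_col (a \<cdot>\<^sub>m gram A us vs + b \<cdot>\<^sub>m gram B us vs)"
  hence i: "i < length us" and j: "j < length vs" by (auto simp: gram_def)
  have u: "us ! i \<in> carrier_vec n" and v: "vs ! j \<in> carrier_vec n" using i j us vs nth_mem by blast+
  have "(a \<cdot>\<^sub>m A + b \<cdot>\<^sub>m B) *\<^sub>v vs ! j = a \<cdot>\<^sub>v (A *\<^sub>v vs ! j) + b \<cdot>\<^sub>v (B *\<^sub>v vs ! j)"
    using A B v by (simp add: add_mult_distrib_mat_vec[of _ n n] smult_mat_mult_vec[of _ n n])
  moreover have "us ! i \<bullet> (a \<cdot>\<^sub>v (A *\<^sub>v vs ! j) + b \<cdot>\<^sub>v (B *\<^sub>v vs ! j)) =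
      a * (us ! i \<bullet> (A *\<^sub>v vs ! j)) + b * (us ! i \<bullet> (B *\<^sub>v vs ! j))"
    using A B u v by (simp add: scalar_prod_add_distrib[of _ n])
  ultimately show "gram (a \<cdot>\<^sub>m A + b \<cdot>\<^sub>m B) us vs $$ (i, j) = (a \<cdot>\<^sub>m gram A us vs + b \<cdot>\<^sub>m gram B us vs) $$ (i, j)"
    using i j by (simp add: gram_def)
qed (auto simp: gram_def)

section \<open>The canonical blocks\<close>

lemma F_bar_dims [simp]:
  "dim_row (F_bar a b rs) = sum_list rs" "dim_col (F_bar a b rs) = sum_list rs + length rs"
  by (induction rs) (auto simp: F_bar_def Let_def U_block_def)

lemma F_bar_append_one:
  "F_bar a b (rs @ [k]) = four_block_mat (F_bar a b rs) (0\<^sub>m (sum_list rs) (Suc k))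
     (0\<^sub>m k (sum_list rs + length rs)) (U_block a b k)"
proof -
  have "dim_row (U_block a b k) = k" "dim_col (U_block a b k) = Suc k" by (auto simp: U_block_def)
  thus ?thesis
    using F_bar_dims[of a b rs] by (simp add: F_bar_def diag_block_mat_last Let_def)
qed

lemma four_block_mat_linear:
  fixes A1 :: "'a::comm_ring_1 mat"
  assumes "A1 \<in> carrier_mat nr1 nc1" "B1 \<in> carrier_mat nr1 nc2" "C1 \<in> carrier_mat nr2 nc1" "D1 \<in> carrier_mat nr2 nc2"
    and "A2 \<in> carrier_mat nr1 nc1" "B2 \<in> carrier_mat nr1 nc2" "C2 \<in> carrier_mat nr2 nc1" "D2 \<in> carrier_mat nr2 nc2"
  shows "a \<cdot>\<^sub>m four_block_mat A1 B1 C1 D1 + b \<cdot>\<^sub>m four_block_mat A2 B2 C2 D2 =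
    four_block_mat (a \<cdot>\<^sub>m A1 + b \<cdot>\<^sub>m A2) (a \<cdot>\<^sub>m B1 + b \<cdot>\<^sub>m B2) (a \<cdot>\<^sub>m C1 + b \<cdot>\<^sub>m C2) (a \<cdot>\<^sub>m D1 + b \<cdot>\<^sub>m D2)"
  using assms by (intro eq_matI) auto

lemma F_bar_linear:
  fixes a b :: "'a::field"
  shows "F_bar a b rs = a \<cdot>\<^sub>m F_bar 1 0 rs + b \<cdot>\<^sub>m F_bar 0 1 rs"
proof (induction rs)
  case Nil
  show ?case by (auto simp: F_bar_def)
next
  case (Cons k rs)
  let ?z1 = "0\<^sub>m k (sum_list rs + length rs) :: 'a mat" and ?z2 = "0\<^sub>m (sum_list rs) (Suc k) :: 'a mat"
  have d: "F_bar c d rs \<in> carrier_mat (sum_list rs) (sum_list rs + length rs)"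
    "U_block c d k \<in> carrier_mat k (Suc k)" for c d :: 'a
    by (auto simp: U_block_def)
  have rec: "F_bar c d (k # rs) = four_block_mat (U_block c d k) ?z1 ?z2 (F_bar c d rs)" for c d :: 'a
    using F_bar_dims[of c d rs] d(2)[of c d] by (simp add: F_bar_def Let_def)
  have U: "U_block a b k = a \<cdot>\<^sub>m U_block 1 0 k + b \<cdot>\<^sub>m U_block 0 1 k"
    by (rule eq_matI) (auto simp: U_block_def)
  have z: "a \<cdot>\<^sub>m ?z1 + b \<cdot>\<^sub>m ?z1 = ?z1" "a \<cdot>\<^sub>m ?z2 + b \<cdot>\<^sub>m ?z2 = ?z2" by auto
  have "a \<cdot>\<^sub>m F_bar 1 0 (k # rs) + b \<cdot>\<^sub>m F_bar 0 1 (k # rs) =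
      four_block_mat (a \<cdot>\<^sub>m U_block 1 0 k + b \<cdot>\<^sub>m U_block 0 1 k) (a \<cdot>\<^sub>m ?z1 + b \<cdot>\<^sub>m ?z1) (a \<cdot>\<^sub>m ?z2 + b \<cdot>\<^sub>m ?z2)
        (a \<cdot>\<^sub>m F_bar 1 0 rs + b \<cdot>\<^sub>m F_bar 0 1 rs)"
    unfolding rec by (rule four_block_mat_linear[OF d(2) _ _ d(1) d(2) _ _ d(1)]) auto
  thus ?case unfolding rec z U[symmetric] Cons.IH[symmetric] by simp
qed

lemma four_block_mat_eq_0:
  "four_block_mat (0\<^sub>m a c) (0\<^sub>m a d) (0\<^sub>m b c) (0\<^sub>m b d) = 0\<^sub>m (a + b) (c + d)"
  by (rule eq_matI) auto

text \<open>The kernel of one block is spanned by the vector with \<open>y\<close>-part zero and \<open>x\<close>-part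
  \<open>((- a)\<^sup>i b\<^sup>k\<^sup>-\<^sup>i)\<close>: one of the two end coordinates of the \<open>x\<close>-part determines the others,
  according to which of \<open>a\<close>, \<open>b\<close> is nonzero.\<close>

lemma kernel_dim_F_mat_single:
  fixes a b :: "'a::field"
  assumes ab: "(a, b) \<noteq> (0, 0)" and k: "0 < k"
  shows "kernel_dim (F_mat a b [k]) = 1"
proof -
  define n where "n = k + Suc k"
  define F where "F = F_mat a b [k]"
  have F_eq: "F = four_block_mat (0\<^sub>m k k) (U_block a b k) (- (U_block a b k)\<^sup>T) (0\<^sub>m (Suc k) (Suc k))"
    using diag_block_mat_singleton[of "U_block a b k"] by (simp add: F_def F_mat_def F_bar_def)
  have F: "F \<in> carrier_mat n n" unfolding F_eq n_def by (auto simp: U_block_def)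
  have ent: "F $$ (i, j) = (if i < k then (if j = k + i then a else if j = Suc (k + i) then b else 0)
       else if j < k then (if i = k + j then - a else if i = Suc (k + j) then - b else 0) else 0)"
    if "i < n" "j < n" for i j
    using that unfolding F_eq n_def by (auto simp: U_block_def)
  have top: "(F *\<^sub>v v) $ i = a * v $ (k + i) + b * v $ Suc (k + i)" if "i < k" "v \<in> carrier_vec n" for i v
  proof -
    have "(F *\<^sub>v v) $ i = (\<Sum>j<n. F $$ (i, j) * v $ j)"
      using that F by (auto simp: scalar_prod_def atLeast0LessThan n_def)
    also have "\<dots> = (\<Sum>j<n. (if j = k + i then a * v $ (k + i) else 0) + (if j = Suc (k + i) then b * v $ Suc (k + i) else 0))"
      using that by (intro sum.cong) (auto simp: ent n_def)
    finally show ?thesis using that by (simp add: sum.distrib n_def)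
  qed
  have bot: "(F *\<^sub>v v) $ (k + j) = - ((if j < k then a * v $ j else 0) + (if 0 < j then b * v $ (j - 1) else 0))"
    if "j \<le> k" "v \<in> carrier_vec n" for j v
  proof -
    have "(F *\<^sub>v v) $ (k + j) = (\<Sum>i<n. F $$ (k + j, i) * v $ i)"
      using that F by (auto simp: scalar_prod_def atLeast0LessThan n_def)
    also have "\<dots> = (\<Sum>i<n. (if i = j then (if j < k then - a * v $ j else 0) else 0) +
        (if i = j - 1 then (if 0 < j then - b * v $ (j - 1) else 0) else 0))"
      using that k by (intro sum.cong) (auto simp: ent n_def)
    finally show ?thesis using that k by (auto simp: sum.distrib n_def)
  qed
  define g where "g = vec n (\<lambda>i. if i < k then 0 else (- a) ^ (i - k) * b ^ (2 * k - i))"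
  have g: "g \<in> carrier_vec n" by (simp add: g_def)
  have g_ne: "g \<noteq> 0\<^sub>v n"
  proof
    assume 0: "g = 0\<^sub>v n"
    have "g $ k = b ^ k" "g $ (2 * k) = (- a) ^ k" by (auto simp: g_def n_def)
    moreover have "g $ k = 0" "g $ (2 * k) = 0" unfolding 0 by (auto simp: n_def)
    ultimately show False using ab by auto
  qed
  have g_ker: "F *\<^sub>v g = 0\<^sub>v n"
  proof (rule eq_vecI)
    fix i assume "i < dim_vec (0\<^sub>v n :: 'a vec)"
    hence i: "i < n" by simp
    show "(F *\<^sub>v g) $ i = 0\<^sub>v n $ i"
    proof (cases "i < k")
      case True
      define m where "m = k - Suc i"
      have "2 * k - (k + i) = Suc m" "2 * k - Suc (k + i) = m" using True by (auto simp: m_def)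
      thus ?thesis using top[OF True g] i True by (simp add: g_def n_def)
    next
      case False
      thus ?thesis using bot[OF _ g, of "i - k"] i by (auto simp: g_def n_def)
    qed
  qed (use F in simp)
  have multiple: "\<exists>t. v = t \<cdot>\<^sub>v g" if v: "v \<in> carrier_vec n" and Fv: "F *\<^sub>v v = 0\<^sub>v n" for v
  proof -
    have T: "a * v $ (k + i) + b * v $ Suc (k + i) = 0" if "i < k" for i
      using top[OF that v] Fv that by (simp add: n_def)
    have S: "(if j < k then a * v $ j else 0) + (if 0 < j then b * v $ (j - 1) else 0) = 0" if "j \<le> k" for j
    proof -
      have "(F *\<^sub>v v) $ (k + j) = 0" using Fv that by (simp add: n_def)
      thus ?thesis unfolding bot[OF that v] neg_equal_0_iff_equal .
    qed
    have y0: "v $ j = 0" if "j < k" for j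
    proof (cases "a = 0")
      case True
      thus ?thesis using S[of "Suc j"] that ab by (auto split: if_splits)
    next
      case False
      show ?thesis using that
      proof (induction j)
        case 0 thus ?case using S[of 0] False by simp
      next
        case (Suc j) thus ?case using S[of "Suc j"] False by simp
      qed
    qed
    have "\<exists>t. \<forall>i\<le>k. v $ (k + i) = t * ((- a) ^ i * b ^ (k - i))"
    proof (cases "b = 0")
      case False
      have "v $ (k + i) = v $ k / b ^ k * ((- a) ^ i * b ^ (k - i))" if "i \<le> k" for i
        using that
      proof (induction i)
        case 0 thus ?case using False by simp
      next
        case (Suc i)
        have e: "k - i = Suc (k - Suc i)" using Suc.prems by simp
        have "b * v $ (k + Suc i) = - a * v $ (k + i)" using T[of i] Suc.prems by (simp add: eq_neg_iff_add_eq_0 add.commute)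
        also have "\<dots> = b * (v $ k / b ^ k * ((- a) ^ Suc i * b ^ (k - Suc i)))"
          using Suc by (simp add: e)
        finally show ?case unfolding mult_left_cancel[OF False] .
      qed
      thus ?thesis by blast
    next
      case True
      hence a: "a \<noteq> 0" using ab by simp
      have "v $ (k + i) = v $ (2 * k) / (- a) ^ k * ((- a) ^ i * b ^ (k - i))" if "i \<le> k" for i
        using T[of i] True a that by (cases "i = k") (auto simp: power_0_left mult_2)
      thus ?thesis by blast
    qed
    then obtain t where t: "\<And>i. i \<le> k \<Longrightarrow> v $ (k + i) = t * ((- a) ^ i * b ^ (k - i))" by blast
    have "v = t \<cdot>\<^sub>v g"
    proof (rule eq_vecI)
      fix i assume "i < dim_vec (t \<cdot>\<^sub>v g)"
      hence i: "i < n" using g by simp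
      show "v $ i = (t \<cdot>\<^sub>v g) $ i"
      proof (cases "i < k")
        case True thus ?thesis using y0 i by (simp add: g_def)
      next
        case False
        have "2 * k - i = k - (i - k)" using False by simp
        thus ?thesis using t[of "i - k"] i False by (simp add: g_def n_def)
      qed
    qed (use v g in simp)
    thus ?thesis by blast
  qed
  interpret K: kernel n n F by unfold_locales (rule F)
  have gK: "g \<in> mat_kernel F" using mat_kernelI[OF F g g_ker] .
  have "K.Ker.span {g} = mat_kernel F"
  proof
    show "K.Ker.span {g} \<subseteq> mat_kernel F" using K.Ker.span_closed[of "{g}"] gK by auto
    show "mat_kernel F \<subseteq> K.Ker.span {g}"
    proof
      fix v assume "v \<in> mat_kernel F"
      then obtain t where v: "v = t \<cdot>\<^sub>v g" using multiple mat_kernelD[OF F] by blast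
      have "submodule class_ring (K.Ker.span {g}) K.VK"
        by (rule K.Ker.span_is_submodule) (use gK in auto)
      moreover have "g \<in> K.Ker.span {g}" using K.Ker.span_self gK by auto
      ultimately show "v \<in> K.Ker.span {g}" unfolding v submodule_def
        by (auto simp: class_ring_simps module_vec_simps)
    qed
  qed
  hence "K.dim = 1" using K.Ker.dim1I[of g] gK g_ne by auto
  hence "kernel_dim F = 1" by simp
  thus ?thesis unfolding F_def .
qed

section \<open>Splitting off the block of a minimal chain\<close>

lemma gram_biorthogonal:
  assumes "biorthogonal n s \<psi> e" and "b \<le> s" "d \<le> s"
  shows "gram (1\<^sub>m n) (map \<psi> [a..<b]) (map e [c..<d]) =
    mat (b - a) (d - c) (\<lambda>(i, j). if a + i = c + j then 1 else 0)"
  by (rule eq_matI) (use assms in \<open>auto simp: gram_def biorthogonal_def\<close>)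

lemma gram_biorthogonal_same:
  assumes "biorthogonal n s \<psi> e" and "b \<le> s"
  shows "gram (1\<^sub>m n) (map \<psi> [a..<b]) (map e [a..<b]) = 1\<^sub>m (b - a)"
  unfolding gram_biorthogonal[OF assms assms(2)] by (rule eq_matI) auto

lemma gram_biorthogonal_disjoint:
  assumes "biorthogonal n s \<psi> e" and "b \<le> s" "d \<le> s" and "b \<le> c \<or> d \<le> a"
  shows "gram (1\<^sub>m n) (map \<psi> [a..<b]) (map e [c..<d]) = 0\<^sub>m (b - a) (d - c)"
  unfolding gram_biorthogonal[OF assms(1-3)] using assms(4) by (intro eq_matI) auto

lemma kernel_dim_congruence:
  fixes M :: "'a::field mat"
  assumes M: "M \<in> carrier_mat n n" and P: "P \<in> carrier_mat n n" and Q: "Q \<in> carrier_mat n n"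
    and PQ: "P * Q = 1\<^sub>m n"
  shows "kernel_dim (P\<^sup>T * M * P) = kernel_dim M"
proof -
  have PT: "P\<^sup>T \<in> carrier_mat n n" and QT: "Q\<^sup>T \<in> carrier_mat n n" using P Q by auto
  have "Q\<^sup>T * P\<^sup>T = 1\<^sub>m n" using transpose_mult[OF P Q] PQ by simp
  hence "mat_kernel (P\<^sup>T * M) = mat_kernel M" by (rule mat_kernel_mult_eq[OF M PT QT])
  moreover have "kernel.dim n (P\<^sup>T * M * P) = kernel.dim n (P\<^sup>T * M)"
    by (rule mat_kernel_dim_mult_eq_right[OF mult_carrier_mat[OF PT M] P Q PQ])
  ultimately show ?thesis using M P unfolding kernel_dim_def by simp
qed

context dual_chain
begin

definition basis_vec :: "nat \<Rightarrow> 'a vec" where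
  "basis_vec i = (if i < k then y i else x (i - k))"

text \<open>Read off from \<open>yAx\<close>: the coordinate of \<open>y i\<close> is the scalar product with \<open>A x i\<close>, that of \<open>x i\<close> the
  one with \<open>- A y i\<close>.  The last vector \<open>x k\<close> is in the kernel of \<open>A\<close> and is detected by
  \<open>B y (k - 1)\<close> instead.\<close>

definition dual_vec :: "nat \<Rightarrow> 'a vec" where
  "dual_vec i = (if i < k then A *\<^sub>v x i else if i < 2 * k then - (A *\<^sub>v y (i - k))
     else - (B *\<^sub>v y (k - 1)))"

lemma Ay [simp]: "A *\<^sub>v y j \<in> carrier_vec n" and By [simp]: "B *\<^sub>v y j \<in> carrier_vec n"
  using A B y_carrier by auto

lemma Ax [simp]: "i \<le> k \<Longrightarrow> A *\<^sub>v x i \<in> carrier_vec n"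
  using A x_carrier by auto

lemma dual_vec_scalar_prod:
  assumes "z \<in> carrier_vec n" "i \<le> 2 * k"
  shows "dual_vec i \<bullet> z = (if i < k then z \<bullet> (A *\<^sub>v x i)
    else if i < 2 * k then - (z \<bullet> (A *\<^sub>v y (i - k))) else - (z \<bullet> (B *\<^sub>v y (k - 1))))"
  using assms comm_scalar_prod[OF Ax assms(1), of i] comm_scalar_prod[OF Ay assms(1), of "i - k"]
    comm_scalar_prod[OF By assms(1), of "k - 1"] A B
  by (simp add: dual_vec_def)

lemma biorthogonal_block: "biorthogonal n (Suc (2 * k)) dual_vec basis_vec"
  unfolding biorthogonal_def
proof (intro conjI allI impI)
  fix i assume i: "i < Suc (2 * k)"
  show "dual_vec i \<in> carrier_vec n" using Ax Ay By i by (auto simp: dual_vec_def)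
  show b: "basis_vec i \<in> carrier_vec n" using x_carrier y_carrier i by (auto simp: basis_vec_def)
next
  fix i j assume i: "i < Suc (2 * k)" and j: "j < Suc (2 * k)"
  have b: "basis_vec j \<in> carrier_vec n" using x_carrier y_carrier j by (auto simp: basis_vec_def)
  consider "j < k" "basis_vec j = y j" | q where "j = k + q" "q \<le> k" "basis_vec j = x q"
  proof (cases "j < k")
    case False
    have "basis_vec j = x (j - k)" "j = k + (j - k)" "j - k \<le> k" using False j by (auto simp: basis_vec_def)
    thus ?thesis using that(2) by blast
  qed (use that(1) in \<open>simp add: basis_vec_def\<close>)
  note b_cases = this
  consider "i < k" "dual_vec i \<bullet> basis_vec j = basis_vec j \<bullet> (A *\<^sub>v x i)"
    | p where "i = k + p" "p < k" "dual_vec i \<bullet> basis_vec j = - (basis_vec j \<bullet> (A *\<^sub>v y p))"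
    | "i = 2 * k" "dual_vec i \<bullet> basis_vec j = - (basis_vec j \<bullet> (B *\<^sub>v y (k - 1)))"
  proof -
    consider "i < k" | p where "i = k + p" "p < k" | "i = 2 * k"
      using i by (metis le_Suc_ex less_Suc_eq mult_2 nat_add_left_cancel_less not_le)
    thus ?thesis using that dual_vec_scalar_prod[OF b, of i] i by cases auto
  qed
  thus "dual_vec i \<bullet> basis_vec j = (if i = j then 1 else 0)"
  proof cases
    case i: 1
    show ?thesis using b_cases
    proof cases
      case 1
      thus ?thesis using i by (simp add: yAx)
    next
      case (2 q)
      thus ?thesis using i by (simp add: xAx)
    qed
  next
    case i: (2 p)
    show ?thesis using b_cases
    proof cases
      case 1
      thus ?thesis using i by (simp add: yAy)
    next
      case (2 q)
      thus ?thesis using i swap_A[OF x_carrier y_carrier, of q p] yAx[of q p] by simp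
    qed
  next
    case i: 3
    show ?thesis using b_cases
    proof cases
      case 1
      thus ?thesis using i k by (simp add: yBy)
    next
      case (2 q)
      thus ?thesis using i k swap_B[OF x_carrier y_carrier, of q "k - 1"] yBx[of q "k - 1"] by auto
    qed
  qed
qed

text \<open>The \<open>2 k + 1\<close> dual functionals already account for all \<open>2 (2 k + 1)\<close> conditions of orthogonality,
  since \<open>A x i = B x (i + 1)\<close> and \<open>B y i = A y (i + 1)\<close>.\<close>

lemma complement_orthogonal:
  assumes z: "z \<in> carrier_vec n" and 0: "\<And>i. i \<le> 2 * k \<Longrightarrow> dual_vec i \<bullet> z = 0"
  shows "i < k \<Longrightarrow> y i \<bullet> (A *\<^sub>v z) = 0" and "i < k \<Longrightarrow> y i \<bullet> (B *\<^sub>v z) = 0"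
    and "i \<le> k \<Longrightarrow> x i \<bullet> (A *\<^sub>v z) = 0" and "i \<le> k \<Longrightarrow> x i \<bullet> (B *\<^sub>v z) = 0"
proof -
  have zAx: "z \<bullet> (A *\<^sub>v x i) = 0" if "i \<le> k" for i
    using 0[of i] dual_vec_scalar_prod[OF z, of i] that A_xk z by (cases "i = k") auto
  have zAy: "z \<bullet> (A *\<^sub>v y i) = 0" if "i < k" for i
    using 0[of "k + i"] dual_vec_scalar_prod[OF z, of "k + i"] that by simp
  show "y i \<bullet> (A *\<^sub>v z) = 0" if "i < k" using swap_A[OF y_carrier z, of i] zAy[OF that] by simp
  show "x i \<bullet> (A *\<^sub>v z) = 0" if "i \<le> k" using swap_A[OF x_carrier z, of i] zAx that by simp
  show "y i \<bullet> (B *\<^sub>v z) = 0" if "i < k"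
  proof (cases "Suc i < k")
    case True
    thus ?thesis using swap_B[OF y_carrier z, of i] zAy[of "Suc i"] y_step[of i] by simp
  next
    case False
    hence "i = k - 1" using that by simp
    thus ?thesis using swap_B[OF y_carrier z, of i] 0[of "2 * k"] dual_vec_scalar_prod[OF z, of "2 * k"] k by simp
  qed
  show "x i \<bullet> (B *\<^sub>v z) = 0" if "i \<le> k"
  proof (cases i)
    case 0
    thus ?thesis using swap_B[OF x_carrier z, of i] B_x0 z by simp
  next
    case (Suc m)
    thus ?thesis using swap_B[OF x_carrier z, of i] x_step[of m] zAx[of m] that by simp
  qed
qed

abbreviation "ys \<equiv> map y [0..<k]"
abbreviation "xs \<equiv> map x [0..<Suc k]"

lemma ys_xs_carrier: "set ys \<subseteq> carrier_vec n" "set xs \<subseteq> carrier_vec n"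
  using x_carrier y_carrier by auto

lemma gram_map_upt:
  "gram M (map f [0..<a]) (map g [0..<b]) = mat a b (\<lambda>(i, j). f i \<bullet> (M *\<^sub>v g j))"
  by (rule eq_matI) (auto simp: gram_def simp del: upt_Suc)

lemma gram_block:
  "gram A ys ys = 0\<^sub>m k k" "gram A xs xs = 0\<^sub>m (Suc k) (Suc k)" "gram A ys xs = U_block 1 0 k"
  "gram B ys ys = 0\<^sub>m k k" "gram B xs xs = 0\<^sub>m (Suc k) (Suc k)" "gram B ys xs = U_block 0 1 k"
proof -
  show "gram A ys ys = 0\<^sub>m k k" "gram B ys ys = 0\<^sub>m k k"
    unfolding gram_map_upt by (rule eq_matI; simp add: yAy yBy)+
  show "gram A xs xs = 0\<^sub>m (Suc k) (Suc k)" "gram B xs xs = 0\<^sub>m (Suc k) (Suc k)"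
    unfolding gram_map_upt by (rule eq_matI; simp add: xAx xBx)+
  show "gram A ys xs = U_block 1 0 k" "gram B ys xs = U_block 0 1 k"
    unfolding gram_map_upt U_block_def by (rule eq_matI; simp add: yAx yBx)+
qed

text \<open>Extend the block and its dual functionals to a full biorthogonal system.  The dual functionals
  of the block vanish on the added vectors, which therefore span the common orthogonal space of
  the block with respect to \<open>A\<close> and \<open>B\<close>.\<close>

lemma complement_exists:
  "\<exists>\<psi> e. biorthogonal n n \<psi> e \<and> Suc (2 * k) \<le> n \<and> map e [0..<k] = ys \<and> map e [k..<Suc (2 * k)] = xs \<and>
     (\<forall>M\<in>{A, B}. gram M ys (map e [Suc (2 * k)..<n]) = 0\<^sub>m k (n - Suc (2 * k)) \<and>
       gram M xs (map e [Suc (2 * k)..<n]) = 0\<^sub>m (Suc k) (n - Suc (2 * k)))"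
proof -
  let ?s = "Suc (2 * k)"
  have le: "?s \<le> n" by (rule biorthogonal_size_le[OF biorthogonal_block])
  obtain \<psi> e where full: "biorthogonal n n \<psi> e"
    and agree: "\<And>i. i < ?s \<Longrightarrow> \<psi> i = dual_vec i" "\<And>i. i < ?s \<Longrightarrow> e i = basis_vec i"
    using biorthogonal_extend[OF biorthogonal_block le] by blast
  have z1: "e j \<in> carrier_vec n" if "j < n" for j
    using full that by (simp add: biorthogonal_def)
  have z2: "dual_vec i \<bullet> e j = 0" if "?s \<le> j" "j < n" "i \<le> 2 * k" for i j
  proof -
    have "\<psi> i \<bullet> e j = (if i = j then 1 else 0)" using full that by (simp add: biorthogonal_def)
    thus ?thesis using that agree(1)[of i] by simp
  qed
  have "map e [0..<k] = ys" by (auto simp: agree(2) basis_vec_def)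
  moreover have "map e [k..<?s] = xs"
    by (rule nth_equalityI) (auto simp: agree(2) basis_vec_def simp del: upt_Suc)
  moreover have "gram M ys (map e [?s..<n]) = 0\<^sub>m k (n - ?s) \<and> gram M xs (map e [?s..<n]) = 0\<^sub>m (Suc k) (n - ?s)"
    if "M \<in> {A, B}" for M
    using that complement_orthogonal[OF z1 z2]
    by (auto simp: gram_def simp del: upt_Suc intro!: eq_matI)
  ultimately show ?thesis using full le by blast
qed

end

section \<open>Normal bases\<close>

text \<open>The dual lists witness that \<open>ys @ xs\<close> is linearly independent, in a form that is stable under
  forming direct sums.\<close>

definition normal_basis ::
    "nat \<Rightarrow> 'a::field mat \<Rightarrow> 'a mat \<Rightarrow> nat list \<Rightarrow> 'a vec list \<Rightarrow> 'a vec list \<Rightarrow> bool" where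
  "normal_basis n A B rs ys xs \<longleftrightarrow>
     set ys \<subseteq> carrier_vec n \<and> set xs \<subseteq> carrier_vec n \<and>
     length ys = sum_list rs \<and> length xs = sum_list rs + length rs \<and>
     (\<forall>(M, F) \<in> {(A, F_bar 1 0 rs), (B, F_bar 0 1 rs)}.
        gram M ys ys = 0\<^sub>m (length ys) (length ys) \<and> gram M xs xs = 0\<^sub>m (length xs) (length xs) \<and>
        gram M ys xs = F) \<and>
     (\<exists>\<phi>s \<chi>s. set \<phi>s \<subseteq> carrier_vec n \<and> set \<chi>s \<subseteq> carrier_vec n \<and>
        length \<phi>s = length ys \<and> length \<chi>s = length xs \<and>
        gram (1\<^sub>m n) \<phi>s ys = 1\<^sub>m (length ys) \<and> gram (1\<^sub>m n) \<phi>s xs = 0\<^sub>m (length ys) (length xs) \<and>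
        gram (1\<^sub>m n) \<chi>s ys = 0\<^sub>m (length xs) (length ys) \<and> gram (1\<^sub>m n) \<chi>s xs = 1\<^sub>m (length xs))"

lemma gram_direct_sum:
  assumes M: "M \<in> carrier_mat n n"
    and ws: "set ws \<subseteq> carrier_vec n" and zs: "set zs \<subseteq> carrier_vec n" "length zs = length ws"
    and us: "set us \<subseteq> carrier_vec n" and vs: "set vs \<subseteq> carrier_vec n"
    and us': "set us' \<subseteq> carrier_vec (length ws)" and vs': "set vs' \<subseteq> carrier_vec (length ws)"
    and orth: "gram M ws vs = 0\<^sub>m (length ws) (length vs)" "gram M us zs = 0\<^sub>m (length us) (length ws)"
  shows "gram M (map ((*\<^sub>v) (mat_of_cols n ws)) us' @ us) (map ((*\<^sub>v) (mat_of_cols n zs)) vs' @ vs) =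
    four_block_mat (gram (gram M ws zs) us' vs') (0\<^sub>m (length us') (length vs))
      (0\<^sub>m (length us) (length vs')) (gram M us vs)"
proof -
  have "gram M (map ((*\<^sub>v) (mat_of_cols n ws)) us') vs = 0\<^sub>m (length us') (length vs)"
    unfolding gram_map_left[OF M ws vs us'] orth by (rule right_mult_zero_mat) auto
  moreover have "gram M us (map ((*\<^sub>v) (mat_of_cols n zs)) vs') = 0\<^sub>m (length us) (length vs')"
    unfolding gram_map_right[OF M zs(1) us vs'[folded zs(2)]] orth zs(2)
    by (rule left_mult_zero_mat) auto
  moreover have "gram M (map ((*\<^sub>v) (mat_of_cols n ws)) us') (map ((*\<^sub>v) (mat_of_cols n zs)) vs') =
      gram (gram M ws zs) us' vs'"
    by (rule gram_map_both[OF M ws zs(1) us' vs' refl zs(2)])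
  ultimately show ?thesis unfolding gram_append by simp
qed

lemma four_block_one_mat:
  "four_block_mat (1\<^sub>m a) (0\<^sub>m a b) (0\<^sub>m b a) (1\<^sub>m b) = (1\<^sub>m (a + b) :: 'a::{zero,one} mat)"
  by (rule eq_matI) auto

text \<open>The complement is identified with coordinate vectors of length \<open>m\<close> by the matrix \<open>Z\<close> with columns \<open>zs\<close>; the pencil
  restricted to it consists of the Gram matrices of \<open>zs\<close>.\<close>

locale split_chain = dual_chain +
  fixes \<psi> e :: "nat \<Rightarrow> 'a vec" and zs :: "'a vec list"
  assumes bi: "biorthogonal n n \<psi> e" and le: "Suc (2 * k) \<le> n"
    and e: "map e [0..<k] = ys" "map e [k..<Suc (2 * k)] = xs"
    and zs_def: "zs = map e [Suc (2 * k)..<n]"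
    and orth: "\<And>M. M \<in> {A, B} \<Longrightarrow> gram M ys zs = 0\<^sub>m k (n - Suc (2 * k)) \<and>
      gram M xs zs = 0\<^sub>m (Suc k) (n - Suc (2 * k))"
begin

abbreviation "m \<equiv> n - Suc (2 * k)"

lemma e_carrier: "i < n \<Longrightarrow> e i \<in> carrier_vec n"
  and psi_carrier: "i < n \<Longrightarrow> \<psi> i \<in> carrier_vec n"
  using bi by (auto simp: biorthogonal_def)

lemma zs_carrier: "set zs \<subseteq> carrier_vec n" and length_zs: "length zs = m"
  using e_carrier by (auto simp: zs_def simp del: upt_Suc)

lemma Z_carrier: "mat_of_cols n zs \<in> carrier_mat n m"
  using length_zs by auto

text \<open>Both lists grow at the end: the new \<open>ys\<close> follow those of the complement and the new
  \<open>xs\<close> follow its \<open>xs\<close>, so that the off-diagonal part of the Gram matrix is \<open>F_bar\<close> of the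
  extended list without any permutation.\<close>

lemma normal_basis_extend:
  assumes nb: "normal_basis m (gram A zs zs) (gram B zs zs) rs ys' xs'"
  shows "normal_basis n A B (rs @ [k]) (map ((*\<^sub>v) (mat_of_cols n zs)) ys' @ ys)
    (map ((*\<^sub>v) (mat_of_cols n zs)) xs' @ xs)"
proof -
  define \<omega>s where "\<omega>s = map \<psi> [Suc (2 * k)..<n]"
  define \<phi>0 where "\<phi>0 = map \<psi> [0..<k]"
  define \<chi>0 where "\<chi>0 = map \<psi> [k..<Suc (2 * k)]"
  have \<omega>s: "set \<omega>s \<subseteq> carrier_vec n"
    and \<phi>0: "set \<phi>0 \<subseteq> carrier_vec n" and \<chi>0: "set \<chi>0 \<subseteq> carrier_vec n"
    using psi_carrier le by (auto simp: \<omega>s_def \<phi>0_def \<chi>0_def simp del: upt_Suc)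
  have len: "length zs = m" "length \<omega>s = m" "length \<phi>0 = k" "length \<chi>0 = Suc k"
    by (auto simp: length_zs \<omega>s_def \<phi>0_def \<chi>0_def simp del: upt_Suc)
  obtain \<phi>s \<chi>s where nb':
    "set ys' \<subseteq> carrier_vec m" "set xs' \<subseteq> carrier_vec m"
    "length ys' = sum_list rs" "length xs' = sum_list rs + length rs"
    "gram (gram A zs zs) ys' ys' = 0\<^sub>m (length ys') (length ys')"
    "gram (gram A zs zs) xs' xs' = 0\<^sub>m (length xs') (length xs')"
    "gram (gram A zs zs) ys' xs' = F_bar 1 0 rs"
    "gram (gram B zs zs) ys' ys' = 0\<^sub>m (length ys') (length ys')"
    "gram (gram B zs zs) xs' xs' = 0\<^sub>m (length xs') (length xs')"
    "gram (gram B zs zs) ys' xs' = F_bar 0 1 rs"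
    and d: "set \<phi>s \<subseteq> carrier_vec m" "set \<chi>s \<subseteq> carrier_vec m"
      "length \<phi>s = length ys'" "length \<chi>s = length xs'"
      "gram (1\<^sub>m m) \<phi>s ys' = 1\<^sub>m (length ys')" "gram (1\<^sub>m m) \<phi>s xs' = 0\<^sub>m (length ys') (length xs')"
      "gram (1\<^sub>m m) \<chi>s ys' = 0\<^sub>m (length xs') (length ys')" "gram (1\<^sub>m m) \<chi>s xs' = 1\<^sub>m (length xs')"
    using nb unfolding normal_basis_def by auto
  have G: "gram M zs vs = 0\<^sub>m m (length vs) \<and> gram M vs zs = 0\<^sub>m (length vs) m"
    if "M \<in> {A, B}" "vs = ys \<or> vs = xs" for M vs
  proof -
    have vs: "set vs \<subseteq> carrier_vec n" using that(2) ys_xs_carrier by (auto simp del: upt_Suc)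
    have M: "M \<in> carrier_mat n n" "skew_symmetric_mat M" using that A B skew_A skew_B by auto
    have 0: "gram M vs zs = 0\<^sub>m (length vs) m" using orth[OF that(1)] that(2) by (auto simp del: upt_Suc)
    have "gram M zs vs = 0\<^sub>m m (length vs)"
      unfolding gram_skew_transpose[OF M vs zs_carrier] 0 by (intro eq_matI) auto
    thus ?thesis using 0 by blast
  qed
  have sum: "gram M (map ((*\<^sub>v) (mat_of_cols n zs)) us' @ us) (map ((*\<^sub>v) (mat_of_cols n zs)) vs' @ vs) =
      four_block_mat (gram (gram M zs zs) us' vs') (0\<^sub>m (length us') (length vs))
        (0\<^sub>m (length us) (length vs')) (gram M us vs)"
    if "M \<in> {A, B}" "us = ys \<or> us = xs" "vs = ys \<or> vs = xs"
      "set us' \<subseteq> carrier_vec m" "set vs' \<subseteq> carrier_vec m" for M us vs us' vs'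
    by (rule gram_direct_sum) (use that A B ys_xs_carrier zs_carrier G len in \<open>auto simp del: upt_Suc\<close>)
  have one: "gram (1\<^sub>m n) \<omega>s zs = 1\<^sub>m m"
    using gram_biorthogonal_same[OF bi, of n "Suc (2 * k)"] by (simp add: \<omega>s_def zs_def del: upt_Suc)
  have \<omega>0: "gram (1\<^sub>m n) \<omega>s ys = 0\<^sub>m m k" "gram (1\<^sub>m n) \<omega>s xs = 0\<^sub>m m (Suc k)"
    and \<phi>z: "gram (1\<^sub>m n) \<phi>0 zs = 0\<^sub>m k m" and \<chi>z: "gram (1\<^sub>m n) \<chi>0 zs = 0\<^sub>m (Suc k) m"
    and block: "gram (1\<^sub>m n) \<phi>0 ys = 1\<^sub>m k" "gram (1\<^sub>m n) \<phi>0 xs = 0\<^sub>m k (Suc k)"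
      "gram (1\<^sub>m n) \<chi>0 ys = 0\<^sub>m (Suc k) k" "gram (1\<^sub>m n) \<chi>0 xs = 1\<^sub>m (Suc k)"
    using gram_biorthogonal_disjoint[OF bi, of n k 0 "Suc (2 * k)"]
      gram_biorthogonal_disjoint[OF bi, of n "Suc (2 * k)" k "Suc (2 * k)"]
      gram_biorthogonal_disjoint[OF bi, of k n "Suc (2 * k)" 0]
      gram_biorthogonal_disjoint[OF bi, of "Suc (2 * k)" n "Suc (2 * k)" k]
      gram_biorthogonal_same[OF bi, of k 0] gram_biorthogonal_same[OF bi, of "Suc (2 * k)" k]
      gram_biorthogonal_disjoint[OF bi, of k "Suc (2 * k)" k 0]
      gram_biorthogonal_disjoint[OF bi, of "Suc (2 * k)" k 0 k] le
    unfolding e \<omega>s_def zs_def \<phi>0_def \<chi>0_def by (auto simp del: upt_Suc)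
  have sum1: "gram (1\<^sub>m n) (map ((*\<^sub>v) (mat_of_cols n \<omega>s)) us' @ us) (map ((*\<^sub>v) (mat_of_cols n zs)) vs' @ vs) =
      four_block_mat (gram (1\<^sub>m m) us' vs') (0\<^sub>m (length us') (length vs))
        (0\<^sub>m (length us) (length vs')) (gram (1\<^sub>m n) us vs)"
    if "us = \<phi>0 \<or> us = \<chi>0" "vs = ys \<or> vs = xs"
      "set us' \<subseteq> carrier_vec m" "set vs' \<subseteq> carrier_vec m" for us vs us' vs'
    unfolding one[symmetric]
    by (rule gram_direct_sum)
      (use that ys_xs_carrier zs_carrier \<omega>s \<phi>0 \<chi>0 \<omega>0 \<phi>z \<chi>z len in \<open>auto simp del: upt_Suc\<close>)
  have W: "mat_of_cols n \<omega>s \<in> carrier_mat n m" using len by auto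
  have F: "four_block_mat (F_bar a b rs) (0\<^sub>m (length ys') (length xs)) (0\<^sub>m (length ys) (length xs')) (U_block a b k)
      = F_bar a b (rs @ [k])" for a b :: 'a
    unfolding F_bar_append_one using nb' by simp
  show ?thesis
    unfolding normal_basis_def
  proof (intro conjI exI)
    show "set (map ((*\<^sub>v) (mat_of_cols n zs)) ys' @ ys) \<subseteq> carrier_vec n"
      "set (map ((*\<^sub>v) (mat_of_cols n zs)) xs' @ xs) \<subseteq> carrier_vec n"
      using map_mult_carrier[OF Z_carrier] nb' ys_xs_carrier by (auto simp del: upt_Suc)
    show "set (map ((*\<^sub>v) (mat_of_cols n \<omega>s)) \<phi>s @ \<phi>0) \<subseteq> carrier_vec n"
      "set (map ((*\<^sub>v) (mat_of_cols n \<omega>s)) \<chi>s @ \<chi>0) \<subseteq> carrier_vec n"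
      using map_mult_carrier[OF W] d \<phi>0 \<chi>0 by (auto simp del: upt_Suc)
    show "\<forall>(M, F)\<in>{(A, F_bar 1 0 (rs @ [k])), (B, F_bar 0 1 (rs @ [k]))}.
        gram M (map ((*\<^sub>v) (mat_of_cols n zs)) ys' @ ys) (map ((*\<^sub>v) (mat_of_cols n zs)) ys' @ ys) =
          0\<^sub>m (length (map ((*\<^sub>v) (mat_of_cols n zs)) ys' @ ys)) (length (map ((*\<^sub>v) (mat_of_cols n zs)) ys' @ ys)) \<and>
        gram M (map ((*\<^sub>v) (mat_of_cols n zs)) xs' @ xs) (map ((*\<^sub>v) (mat_of_cols n zs)) xs' @ xs) =
          0\<^sub>m (length (map ((*\<^sub>v) (mat_of_cols n zs)) xs' @ xs)) (length (map ((*\<^sub>v) (mat_of_cols n zs)) xs' @ xs)) \<and>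
        gram M (map ((*\<^sub>v) (mat_of_cols n zs)) ys' @ ys) (map ((*\<^sub>v) (mat_of_cols n zs)) xs' @ xs) = F"
      using sum nb' gram_block F[of 1 0] F[of 0 1] by (simp add: four_block_mat_eq_0 del: upt_Suc)
  qed (use nb' d sum1 block len four_block_mat_eq_0 four_block_one_mat in \<open>simp_all del: upt_Suc\<close>)
qed

text \<open>The block is orthogonal to \<open>M1 (Z v)\<close> and \<open>M2 (Z w)\<close>, so these two vectors can only be told apart by
  their scalar products with \<open>zs\<close>, which the restricted pencil records.\<close>

lemma complement_lift:
  assumes M: "M1 \<in> {A, B}" "M2 \<in> {A, B}" and v: "v \<in> carrier_vec m" and w: "w \<in> carrier_vec m"
    and eq: "gram M1 zs zs *\<^sub>v v = gram M2 zs zs *\<^sub>v w"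
  shows "M1 *\<^sub>v (mat_of_cols n zs *\<^sub>v v) = M2 *\<^sub>v (mat_of_cols n zs *\<^sub>v w)"
proof -
  let ?Z = "mat_of_cols n zs"
  let ?u1 = "M1 *\<^sub>v (?Z *\<^sub>v v)" and ?u2 = "M2 *\<^sub>v (?Z *\<^sub>v w)"
  have Mc: "M1 \<in> carrier_mat n n" "M2 \<in> carrier_mat n n" using M A B by auto
  have uc: "?u1 \<in> carrier_vec n" "?u2 \<in> carrier_vec n" using Mc Z_carrier v w by auto
  have part: "us ! i \<bullet> ?u1 = us ! i \<bullet> ?u2"
    if us: "us \<in> {ys, xs, zs}" and i: "i < length us" for us i
  proof -
    have c: "set us \<subseteq> carrier_vec n" using us ys_xs_carrier zs_carrier by (auto simp del: upt_Suc)
    have "gram M1 us zs *\<^sub>v v = gram M2 us zs *\<^sub>v w"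
    proof (cases "us = zs")
      case True
      thus ?thesis using eq by simp
    next
      case False
      hence "gram M us zs = 0\<^sub>m (length us) m" if "M \<in> {A, B}" for M
        using us orth[OF that] by (auto simp del: upt_Suc)
      hence "gram M1 us zs = 0\<^sub>m (length us) m" "gram M2 us zs = 0\<^sub>m (length us) m" using M by auto
      thus ?thesis using v w by (intro eq_vecI) auto
    qed
    thus ?thesis
      using gram_mult_vec[OF Mc(1) c zs_carrier _ i, of v] gram_mult_vec[OF Mc(2) c zs_carrier _ i, of w] v w length_zs
      by simp
  qed
  have "?u1 - ?u2 = 0\<^sub>v n"
  proof (rule biorthogonal_full_eq_zero[OF biorthogonal_sym[OF bi]])
    fix i assume i: "i < n"
    consider "i < k" | "k \<le> i" "i < Suc (2 * k)" | "Suc (2 * k) \<le> i" by linarith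
    hence "\<exists>us\<in>{ys, xs, zs}. \<exists>j<length us. e i = us ! j"
    proof cases
      case 1
      hence "e i = ys ! i" unfolding e(1)[symmetric] by simp
      thus ?thesis using 1 by (intro bexI[of _ ys] exI[of _ i]) auto
    next
      case 2
      hence "e i = xs ! (i - k)" unfolding e(2)[symmetric] by (simp del: upt_Suc)
      thus ?thesis using 2 by (intro bexI[of _ xs] exI[of _ "i - k"]) (auto simp del: upt_Suc)
    next
      case 3
      hence "e i = zs ! (i - Suc (2 * k))" using i by (simp add: zs_def del: upt_Suc)
      thus ?thesis using 3 i length_zs
        by (intro bexI[of _ zs] exI[of _ "i - Suc (2 * k)"]) (auto simp del: upt_Suc)
    qed
    then obtain us j where us: "us \<in> {ys, xs, zs}" "j < length us" "e i = us ! j" by blast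
    have "e i \<bullet> (?u1 - ?u2) = e i \<bullet> ?u1 - e i \<bullet> ?u2"
      by (rule scalar_prod_minus_distrib[OF e_carrier[OF i] uc])
    thus "e i \<bullet> (?u1 - ?u2) = 0" using part[OF us(1,2)] us(3) by simp
  qed (use uc in auto)
  hence d: "(?u1 - ?u2) $ i = 0" if "i < n" for i using that by simp
  show ?thesis
  proof (rule eq_vecI)
    fix i assume "i < dim_vec ?u2"
    hence "i < n" using uc(2) by (metis carrier_vecD)
    thus "?u1 $ i = ?u2 $ i" using d[of i] uc by (metis carrier_vecD eq_iff_diff_eq_0 index_minus_vec(1))
  qed (use Mc in simp)
qed

lemma complement_injective:
  assumes v: "v \<in> carrier_vec m" and 0: "mat_of_cols n zs *\<^sub>v v = 0\<^sub>v n"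
  shows "v = 0\<^sub>v m"
proof -
  define \<omega>s where "\<omega>s = map \<psi> [Suc (2 * k)..<n]"
  have \<omega>s: "set \<omega>s \<subseteq> carrier_vec n" "length \<omega>s = m"
    using psi_carrier by (auto simp: \<omega>s_def simp del: upt_Suc)
  have one: "gram (1\<^sub>m n) \<omega>s zs = 1\<^sub>m m"
    using gram_biorthogonal_same[OF bi, of n "Suc (2 * k)"] by (simp add: \<omega>s_def zs_def del: upt_Suc)
  show ?thesis
  proof (rule eq_vecI)
    fix i assume "i < dim_vec (0\<^sub>v m :: 'a vec)"
    hence i: "i < m" by simp
    hence "\<omega>s ! i \<in> carrier_vec n" using \<omega>s nth_mem by fastforce
    thus "v $ i = 0\<^sub>v m $ i"
      using gram_mult_vec[OF one_carrier_mat \<omega>s(1) zs_carrier, of v i] v i \<omega>s(2) length_zs 0 one by simp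
  qed (use v in simp)
qed

lemma complement_lift_zero:
  assumes M: "M \<in> {A, B}" and u: "u \<in> carrier_vec m" "gram M zs zs *\<^sub>v u = 0\<^sub>v m"
  shows "M *\<^sub>v (mat_of_cols n zs *\<^sub>v u) = 0\<^sub>v n"
proof -
  have G: "gram M zs zs \<in> carrier_mat m m" using gram_carrier[of M zs zs] length_zs by simp
  have "gram M zs zs *\<^sub>v u = gram M zs zs *\<^sub>v 0\<^sub>v m" unfolding u(2) using G by (auto intro!: eq_vecI)
  hence "M *\<^sub>v (mat_of_cols n zs *\<^sub>v u) = M *\<^sub>v (mat_of_cols n zs *\<^sub>v 0\<^sub>v m)"
    by (rule complement_lift[OF M M u(1) zero_carrier_vec])
  also have "mat_of_cols n zs *\<^sub>v 0\<^sub>v m = 0\<^sub>v n" using Z_carrier by (intro eq_vecI) auto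
  also have "M *\<^sub>v 0\<^sub>v n = 0\<^sub>v n" using M A B by (intro eq_vecI) auto
  finally show ?thesis .
qed

lemma nondegenerate_complement:
  assumes nondeg: "\<And>v. v \<in> carrier_vec n \<Longrightarrow> A *\<^sub>v v = 0\<^sub>v n \<Longrightarrow> B *\<^sub>v v = 0\<^sub>v n \<Longrightarrow> v = 0\<^sub>v n"
    and v: "v \<in> carrier_vec m" "gram A zs zs *\<^sub>v v = 0\<^sub>v m" "gram B zs zs *\<^sub>v v = 0\<^sub>v m"
  shows "v = 0\<^sub>v m"
  using complement_injective[OF v(1)] nondeg[OF mult_mat_vec_carrier[OF Z_carrier v(1)]]
    complement_lift_zero[of A v] complement_lift_zero[of B v] v by simp

lemma has_chain_lift:
  assumes "has_chain m (gram A zs zs) (gram B zs zs) j"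
  shows "has_chain n A B j"
proof -
  let ?Z = "mat_of_cols n zs"
  obtain v where v: "kernel_chain m (gram A zs zs) (gram B zs zs) j v" and ne: "\<exists>i\<le>j. v i \<noteq> 0\<^sub>v m"
    using assms unfolding has_chain_def by blast
  have vc: "\<And>i. i \<le> j \<Longrightarrow> v i \<in> carrier_vec m" using v by (auto simp: kernel_chain_def)
  have "kernel_chain n A B j (\<lambda>i. ?Z *\<^sub>v v i)"
    unfolding kernel_chain_def
  proof (intro conjI allI impI)
    show "?Z *\<^sub>v v i \<in> carrier_vec n" if "i \<le> j" for i using Z_carrier vc[OF that] by auto
    show "B *\<^sub>v (?Z *\<^sub>v v 0) = 0\<^sub>v n" by (rule complement_lift_zero) (use v in \<open>auto simp: kernel_chain_def\<close>)
    show "A *\<^sub>v (?Z *\<^sub>v v j) = 0\<^sub>v n" by (rule complement_lift_zero) (use v in \<open>auto simp: kernel_chain_def\<close>)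
    show "A *\<^sub>v (?Z *\<^sub>v v i) = B *\<^sub>v (?Z *\<^sub>v v (Suc i))" if "i < j" for i
      by (rule complement_lift) (use that v in \<open>auto simp: kernel_chain_def\<close>)
  qed
  moreover have "\<exists>i\<le>j. ?Z *\<^sub>v v i \<noteq> 0\<^sub>v n" using ne complement_injective vc by blast
  ultimately show ?thesis unfolding has_chain_def by blast
qed

end

lemma skew_symmetric_pencil:
  fixes A B :: "'a::field mat"
  assumes "A \<in> carrier_mat n n" "B \<in> carrier_mat n n" "skew_symmetric_mat A" "skew_symmetric_mat B"
  shows "skew_symmetric_mat (a \<cdot>\<^sub>m A + b \<cdot>\<^sub>m B)"
proof -
  have e: "M $$ (j, i) = - M $$ (i, j)" if "M \<in> {A, B}" "i < n" "j < n" for M i j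
  proof -
    have M: "M \<in> carrier_mat n n" "M\<^sup>T = - M" using that assms by (auto simp: skew_symmetric_mat_def)
    have "M\<^sup>T $$ (i, j) = - M $$ (i, j)" unfolding M(2) using M(1) that by simp
    thus ?thesis using M(1) that by simp
  qed
  show ?thesis unfolding skew_symmetric_mat_def
  proof (rule eq_matI)
    fix i j assume "i < dim_row (- (a \<cdot>\<^sub>m A + b \<cdot>\<^sub>m B))" "j < dim_col (- (a \<cdot>\<^sub>m A + b \<cdot>\<^sub>m B))"
    hence "i < n" "j < n" using assms(1,2) by auto
    thus "(a \<cdot>\<^sub>m A + b \<cdot>\<^sub>m B)\<^sup>T $$ (i, j) = (- (a \<cdot>\<^sub>m A + b \<cdot>\<^sub>m B)) $$ (i, j)"
      using e[of A i j] e[of B i j] assms(1,2) by simp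
  qed (use assms(1,2) in auto)
qed

lemma gram_normal_basis:
  fixes A B :: "'a::field mat"
  assumes A: "A \<in> carrier_mat n n" and B: "B \<in> carrier_mat n n"
    and skew: "skew_symmetric_mat A" "skew_symmetric_mat B"
    and us: "set us \<subseteq> carrier_vec n" "length us = sum_list rs"
    and vs: "set vs \<subseteq> carrier_vec n" "length vs = sum_list rs + length rs"
    and gA: "gram A us us = 0\<^sub>m (length us) (length us)" "gram A vs vs = 0\<^sub>m (length vs) (length vs)"
      "gram A us vs = F_bar 1 0 rs"
    and gB: "gram B us us = 0\<^sub>m (length us) (length us)" "gram B vs vs = 0\<^sub>m (length vs) (length vs)"
      "gram B us vs = F_bar 0 1 rs"
  shows "gram (a \<cdot>\<^sub>m A + b \<cdot>\<^sub>m B) (us @ vs) (us @ vs) = F_mat a b rs"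
proof -
  let ?M = "a \<cdot>\<^sub>m A + b \<cdot>\<^sub>m B"
  have M: "?M \<in> carrier_mat n n" using A B by simp
  have uv: "gram ?M us vs = F_bar a b rs"
    unfolding gram_pencil[OF A B us(1) vs(1)] gA gB F_bar_linear[symmetric] ..
  have vu: "gram ?M vs us = - (F_bar a b rs)\<^sup>T"
    using gram_skew_transpose[OF M skew_symmetric_pencil[OF A B skew] us(1) vs(1)] uv by simp
  have uu: "gram ?M us us = 0\<^sub>m (sum_list rs) (sum_list rs)"
    unfolding gram_pencil[OF A B us(1) us(1)] gA gB us(2) by auto
  have vv: "gram ?M vs vs = 0\<^sub>m (sum_list rs + length rs) (sum_list rs + length rs)"
    unfolding gram_pencil[OF A B vs(1) vs(1)] gA gB vs(2) by auto
  show ?thesis unfolding gram_append uu uv vu vv F_mat_def Let_def ..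
qed

text \<open>In the basis \<open>e\<close> every member of the pencil is block diagonal, and the block of the chain
  has a one-dimensional kernel.\<close>

lemma (in split_chain) kernel_dim_split:
  assumes ab: "(a, b) \<noteq> (0, 0)"
  shows "kernel_dim (a \<cdot>\<^sub>m A + b \<cdot>\<^sub>m B) = Suc (kernel_dim (a \<cdot>\<^sub>m gram A zs zs + b \<cdot>\<^sub>m gram B zs zs))"
proof -
  let ?s = "Suc (2 * k)"
  define M where "M = a \<cdot>\<^sub>m A + b \<cdot>\<^sub>m B"
  have M: "M \<in> carrier_mat n n" using A B by (simp add: M_def)
  have skew_M: "skew_symmetric_mat M"
    unfolding M_def by (rule skew_symmetric_pencil[OF A B skew_A skew_B])
  define bs where "bs = ys @ xs"
  have bs: "set bs \<subseteq> carrier_vec n" "length bs = ?s"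
    using ys_xs_carrier by (auto simp: bs_def simp del: upt_Suc)
  have bs_zs: "map e [0..<n] = bs @ zs"
  proof -
    have "[0..<n] = ([0..<k] @ [k..<?s]) @ [?s..<n]"
      using upt_add_eq_append[of 0 k "Suc k"] upt_add_eq_append[of 0 ?s m] le
      by (simp add: mult_2 add.assoc[symmetric] del: upt_Suc)
    thus ?thesis unfolding bs_def zs_def e[symmetric] by (simp del: upt_Suc)
  qed
  have U: "F_bar c d [k] = U_block c d k" for c d :: 'a
    using diag_block_mat_singleton[of "U_block c d k"] by (simp add: F_bar_def)
  have block: "gram M bs bs = F_mat a b [k]"
    unfolding M_def bs_def
    by (rule gram_normal_basis[OF A B skew_A skew_B])
      (use ys_xs_carrier gram_block U in \<open>simp_all del: upt_Suc\<close>)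
  have off: "gram M bs zs = 0\<^sub>m ?s m"
  proof -
    have "gram M us zs = 0\<^sub>m (length us) m" if "us \<in> {ys, xs}" for us
    proof -
      have us: "set us \<subseteq> carrier_vec n" using that ys_xs_carrier by (auto simp del: upt_Suc)
      have 0: "gram A us zs = 0\<^sub>m (length us) m" "gram B us zs = 0\<^sub>m (length us) m"
        using that orth[of A] orth[of B] by (auto simp del: upt_Suc)
      show ?thesis unfolding M_def gram_pencil[OF A B us zs_carrier] 0 by auto
    qed
    hence "gram M ys zs = 0\<^sub>m k m" "gram M xs zs = 0\<^sub>m (Suc k) m" by auto
    thus ?thesis
      using four_block_mat_eq_0[of k m 0 "Suc k"] gram_append[of M ys xs zs "[]"] length_zs
      by (auto simp: bs_def gram_def simp del: upt_Suc)
  qed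
  have off': "gram M zs bs = 0\<^sub>m m ?s"
    unfolding gram_skew_transpose[OF M skew_M bs(1) zs_carrier] off by auto
  define P where "P = mat_of_cols n (map e [0..<n])"
  define Q where "Q = mat_of_rows n (map \<psi> [0..<n])"
  have P: "P \<in> carrier_mat n n" and Q: "Q \<in> carrier_mat n n" by (auto simp: P_def Q_def)
  have PQ: "P * Q = 1\<^sub>m n" unfolding P_def Q_def by (rule biorthogonal_full_inverse[OF bi])
  have n: "n = ?s + m" using le by simp
  have G: "gram M zs zs \<in> carrier_mat m m" using gram_carrier[of M zs zs] length_zs by simp
  have K: "F_mat a b [k] \<in> carrier_mat ?s ?s" using gram_carrier[of M bs bs] block bs(2) by simp
  have eset: "set (map e [0..<n]) \<subseteq> carrier_vec n" using e_carrier by auto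
  have "P\<^sup>T * M * P = gram M (map e [0..<n]) (map e [0..<n])"
    unfolding P_def by (rule gram_eq_mult[symmetric, OF M eset eset])
  also have "\<dots> = four_block_mat (F_mat a b [k]) (0\<^sub>m ?s m) (0\<^sub>m m ?s) (gram M zs zs)"
    unfolding bs_zs gram_append block off off' ..
  finally have "P\<^sup>T * M * P = \<dots>" .
  from kernel_four_block_0_mat[OF this K G]
  have "kernel_dim (P\<^sup>T * M * P) = kernel_dim (F_mat a b [k]) + kernel_dim (gram M zs zs)"
    using P M G K n by (simp add: kernel_dim_def)
  thus ?thesis
    unfolding kernel_dim_congruence[OF M P Q PQ] kernel_dim_F_mat_single[OF ab k]
    unfolding M_def gram_pencil[OF A B zs_carrier zs_carrier] by simp
qed

section \<open>Existence of a normal basis\<close>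

text \<open>Chains of the complement are chains of the whole space, so a chain of minimal degree has
  degree at most that of every block found later; adding its block at the end keeps the list
  of degrees weakly decreasing.\<close>

theorem normal_basis_exists:
  fixes A B :: "'a::{alg_closed_field,field_char_0} mat"
  assumes "A \<in> carrier_mat n n" "B \<in> carrier_mat n n"
    and "skew_symmetric_mat A" "skew_symmetric_mat B"
    and "\<And>a b. (a, b) \<noteq> (0, 0) \<Longrightarrow> kernel_dim (a \<cdot>\<^sub>m A + b \<cdot>\<^sub>m B) = h"
    and "\<And>v. v \<in> carrier_vec n \<Longrightarrow> A *\<^sub>v v = 0\<^sub>v n \<Longrightarrow> B *\<^sub>v v = 0\<^sub>v n \<Longrightarrow> v = 0\<^sub>v n"
  shows "\<exists>rs ys xs. normal_basis n A B rs ys xs \<and> n = 2 * sum_list rs + length rs \<and> length rs = h \<and>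
    sorted_wrt (\<ge>) rs \<and> (\<forall>j\<in>set rs. 1 \<le> j \<and> has_chain n A B j)"
  using assms
proof (induction n arbitrary: A B h rule: less_induct)
  case (less n)
  note A = less.prems(1) and B = less.prems(2) and skew = less.prems(3,4)
    and const = less.prems(5) and nondeg = less.prems(6)
  show ?case
  proof (cases "n = 0")
    case True
    have "1 \<cdot>\<^sub>m A + 1 \<cdot>\<^sub>m B \<in> carrier_mat 0 0" using A B True by simp
    hence "kernel_dim (1 \<cdot>\<^sub>m A + 1 \<cdot>\<^sub>m B) = 0" using kernel_dim_eq_0_iff det_dim_zero zero_neq_one by metis
    hence h: "h = 0" using const[of 1 1] by simp
    have "normal_basis n A B [] [] []"
      unfolding normal_basis_def by (auto simp: gram_def F_bar_def intro!: eq_matI)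
    thus ?thesis using True h by (intro exI[of _ "[]"]) auto
  next
    case False
    have "\<exists>k. has_chain n A B k"
      by (rule has_chain_if_pencil_singular[OF A B pencil_singular_if_kernel_dim_constant[OF A B _ const]])
        (use False in auto)
    define k where "k = (LEAST k. has_chain n A B k)"
    have least: "has_chain n A B k" unfolding k_def by (rule LeastI_ex) fact
    have min: "\<not> has_chain n A B l" if "l < k" for l using that not_less_Least unfolding k_def by blast
    obtain x where x: "kernel_chain n A B k x" "\<exists>i\<le>k. x i \<noteq> 0\<^sub>v n"
      using least unfolding has_chain_def by blast
    have x0: "x 0 \<noteq> 0\<^sub>v n" by (rule minimal_chain_start_nonzero[OF A B x min])
    have x0': "x 0 \<in> carrier_vec n" "B *\<^sub>v x 0 = 0\<^sub>v n" using x(1) by (auto simp: kernel_chain_def)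
    have k: "0 < k"
    proof (rule ccontr)
      assume "\<not> 0 < k"
      hence "A *\<^sub>v x 0 = 0\<^sub>v n" using x(1) by (auto simp: kernel_chain_def)
      thus False using nondeg[OF x0'(1)] x0' x0 by blast
    qed
    obtain y where y: "\<And>j. y j \<in> carrier_vec n" "\<And>j. j < k - 1 \<Longrightarrow> A *\<^sub>v y (Suc j) = B *\<^sub>v y j"
      "y 0 \<bullet> (A *\<^sub>v x 0) = 1"
      using dual_sequence_exists[OF A B skew x0'(1) x0 x0'(2) min[of "k - 1"]] k by auto
    interpret dual_chain n A B k x y
      by unfold_locales (use A B skew k x y in auto)
    obtain \<psi> e where pe: "biorthogonal n n \<psi> e" "Suc (2 * k) \<le> n" "map e [0..<k] = ys"
      "map e [k..<Suc (2 * k)] = xs"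
      "\<And>M. M \<in> {A, B} \<Longrightarrow> gram M ys (map e [Suc (2 * k)..<n]) = 0\<^sub>m k (n - Suc (2 * k)) \<and>
        gram M xs (map e [Suc (2 * k)..<n]) = 0\<^sub>m (Suc k) (n - Suc (2 * k))"
      using complement_exists by blast
    interpret split_chain n A B k x y \<psi> e "map e [Suc (2 * k)..<n]"
      by unfold_locales (use pe in auto)
    define zs where "zs = map e [Suc (2 * k)..<n]"
    have G: "gram M zs zs \<in> carrier_mat m m" for M
      using gram_carrier[of M zs zs] by (simp add: zs_def del: upt_Suc)
    have "\<exists>rs ys xs. normal_basis m (gram A zs zs) (gram B zs zs) rs ys xs \<and>
      m = 2 * sum_list rs + length rs \<and> length rs = h - 1 \<and>
      sorted_wrt (\<ge>) rs \<and> (\<forall>j\<in>set rs. 1 \<le> j \<and> has_chain m (gram A zs zs) (gram B zs zs) j)"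
    proof (rule less.IH)
      show "m < n" using False by simp
      show "skew_symmetric_mat (gram A zs zs)" "skew_symmetric_mat (gram B zs zs)"
        using gram_skew_symmetric[OF A skew(1)] gram_skew_symmetric[OF B skew(2)] zs_carrier
        by (auto simp: zs_def simp del: upt_Suc)
      show "kernel_dim (a \<cdot>\<^sub>m gram A zs zs + b \<cdot>\<^sub>m gram B zs zs) = h - 1" if "(a, b) \<noteq> (0, 0)" for a b
        using kernel_dim_split[OF that] const[OF that] by (simp add: zs_def del: upt_Suc)
      show "v = 0\<^sub>v m" if "v \<in> carrier_vec m" "gram A zs zs *\<^sub>v v = 0\<^sub>v m" "gram B zs zs *\<^sub>v v = 0\<^sub>v m" for v
        by (rule nondegenerate_complement[OF nondeg]) (use that in \<open>simp_all only: zs_def\<close>)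
    qed (rule G)+
    then obtain rs ys' xs' where IH: "normal_basis m (gram A zs zs) (gram B zs zs) rs ys' xs'"
      "m = 2 * sum_list rs + length rs" "length rs = h - 1" "sorted_wrt (\<ge>) rs"
      "\<And>j. j \<in> set rs \<Longrightarrow> 1 \<le> j \<and> has_chain m (gram A zs zs) (gram B zs zs) j"
      by blast
    have chains: "1 \<le> j \<and> has_chain n A B j" if "j \<in> set rs" for j
      using IH(5)[OF that] has_chain_lift unfolding zs_def by blast
    have ge: "k \<le> j" if "j \<in> set rs" for j using chains[OF that] min[of j] by (meson not_le)
    have "h \<noteq> 0" using kernel_dim_split[of 1 0] const[of 1 0] by simp
    have "normal_basis n A B (rs @ [k]) (map ((*\<^sub>v) (mat_of_cols n zs)) ys' @ ys)
        (map ((*\<^sub>v) (mat_of_cols n zs)) xs' @ xs)"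
      using normal_basis_extend IH(1) unfolding zs_def by blast
    moreover have "n = 2 * sum_list (rs @ [k]) + length (rs @ [k])" using IH(2) pe(2) by simp
    moreover have "length (rs @ [k]) = h" using IH(3) \<open>h \<noteq> 0\<close> by simp
    moreover have "sorted_wrt (\<ge>) (rs @ [k])" using IH(4) ge by (simp add: sorted_wrt_append)
    moreover have "\<forall>j\<in>set (rs @ [k]). 1 \<le> j \<and> has_chain n A B j" using chains least k by auto
    ultimately show ?thesis by blast
  qed
qed

section \<open>Rank, dimension and determinant\<close>

lemma rank_plus_kernel_dim:
  fixes M :: "'a::field mat"
  assumes M: "M \<in> carrier_mat n n"
  shows "vec_space.rank n M + kernel_dim M = n"
proof -
  interpret vs: vec_space "TYPE('a)" n .
  have "linear_map class_ring vs.V vs.V (\<lambda>v. M *\<^sub>v v)"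
    unfolding linear_map_def mod_hom_def mod_hom_axioms_def LinearCombinations.module_hom_def
    using vec_vs[where 'a = 'a and n = n] vec_module[where 'a = 'a and n = n] M
    by (auto simp: module_vec_simps class_ring_simps mult_add_distrib_mat_vec[of _ n n] mult_mat_vec[of _ n n])
  then interpret T: linear_map class_ring vs.V vs.V "\<lambda>v. M *\<^sub>v v" .
  have "T.imT = vs.span (set (cols M))"
    using vs.col_space_eq[OF M] M unfolding vs.col_space_def T.im_def
    by (auto simp: module_vec_simps)
  moreover have "T.kerT = mat_kernel M"
    unfolding T.ker_def mat_kernel[OF M] by (auto simp: module_vec_simps)
  ultimately show ?thesis
    using T.rank_nullity vs.fin_dim vs.dim_is_n M
    by (simp add: vs.rank_def kernel_dim_def)
qed

lemma fin_dim_matrices: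
  "vectorspace.fin_dim class_ring (module_mat TYPE('a::field) nr nc)"
proof -
  interpret matrix_vs nr nc "TYPE('a)" .
  define E :: "nat \<times> nat \<Rightarrow> 'a mat" where "E p = mat nr nc (\<lambda>q. if q = p then 1 else 0)" for p
  define S where "S = E ` ({..<nr} \<times> {..<nc})"
  have S: "finite S" "S \<subseteq> carrier_mat nr nc" by (auto simp: S_def E_def)
  have sub: "submodule class_ring (span S) V" by (rule span_is_submodule) (use S in simp)
  have part: "mat nr nc (\<lambda>q. if q \<in> T then X $$ q else 0) \<in> span S"
    if "finite T" "T \<subseteq> {..<nr} \<times> {..<nc}" for T and X :: "'a mat"
    using that
  proof (induction T rule: finite_induct)
    case empty
    have "mat nr nc (\<lambda>q. if q \<in> {} then X $$ q else 0) = 0\<^sub>m nr nc" by (intro eq_matI) auto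
    thus ?case using span_zero by simp
  next
    case (insert p T)
    have "E p \<in> span S" using insert.prems S in_own_span[of S] by (auto simp: S_def)
    hence "X $$ p \<cdot>\<^sub>m E p \<in> span S"
      using sub unfolding submodule_def by (simp add: matrix_vs_simps)
    moreover have "mat nr nc (\<lambda>q. if q \<in> T then X $$ q else 0) \<in> span S" using insert by simp
    ultimately have "mat nr nc (\<lambda>q. if q \<in> T then X $$ q else 0) + X $$ p \<cdot>\<^sub>m E p \<in> span S"
      using sub unfolding submodule_def by (simp add: matrix_vs_simps)
    also have "mat nr nc (\<lambda>q. if q \<in> T then X $$ q else 0) + X $$ p \<cdot>\<^sub>m E p =
        mat nr nc (\<lambda>q. if q \<in> insert p T then X $$ q else 0)"
      using insert.hyps by (intro eq_matI) (auto simp: E_def)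
    finally show ?case .
  qed
  have "carrier_mat nr nc \<subseteq> span S"
  proof
    fix X :: "'a mat" assume "X \<in> carrier_mat nr nc"
    hence "X = mat nr nc (\<lambda>q. if q \<in> {..<nr} \<times> {..<nc} then X $$ q else 0)"
      by (intro eq_matI) auto
    thus "X \<in> span S" using part[of "{..<nr} \<times> {..<nc}" X] by simp
  qed
  moreover have "span S \<subseteq> carrier_mat nr nc" using span_is_subset2[of S] S by simp
  ultimately have "span S = carrier_mat nr nc" by simp
  thus ?thesis unfolding fin_dim_def using S by (intro exI[of _ S]) (simp add: matrix_vs_simps)
qed

text \<open>The dimension of a subspace is the size of its smallest finite generating set, so it is
  meaningful only once such a set is known to exist; it does because linearly independent sets
  of \<open>n \<times> n\<close> matrices are bounded in size.\<close>

lemma matrix_subspace_two_basis: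
  fixes M :: "'a::field mat set"
  assumes sub: "matrix_subspace n M" and dim: "matrix_subspace_dim n M = 2"
  shows "\<exists>A\<in>carrier_mat n n. \<exists>B\<in>carrier_mat n n. M = {a \<cdot>\<^sub>m A + b \<cdot>\<^sub>m B | a b. True} \<and>
    (\<forall>a b. a \<cdot>\<^sub>m A + b \<cdot>\<^sub>m B = 0\<^sub>m n n \<longrightarrow> a = 0 \<and> b = 0)"
proof -
  interpret matrix_vs n n "TYPE('a)" .
  have sub': "VectorSpace.subspace class_ring M V" using sub by (simp add: matrix_subspace_def)
  have subm: "submodule class_ring M V" using sub' is_module by blast
  have Mc: "M \<subseteq> carrier_mat n n" using subm by (simp add: submodule_def matrix_vs_simps)
  interpret W: vectorspace class_ring "V\<lparr>carrier := M\<rparr>" by (rule subspace_is_vs[OF sub'])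
  have li: "W.lin_dep S \<longleftrightarrow> lin_dep S" and sp: "W.span S = span S" if "S \<subseteq> M" for S
    using span_li_not_depend[OF that subm] by auto
  have "\<exists>S. finite S \<and> maximal S (\<lambda>S. S \<subseteq> carrier (V\<lparr>carrier := M\<rparr>) \<and> \<not> W.lin_dep S)"
  proof (rule maximal_exists)
    show "finite S \<and> card S \<le> dim" if "S \<subseteq> carrier (V\<lparr>carrier := M\<rparr>) \<and> \<not> W.lin_dep S" for S
      using li_le_dim[OF fin_dim_matrices, of S] that li Mc by auto
    show "{} \<subseteq> carrier (V\<lparr>carrier := M\<rparr>) \<and> \<not> W.lin_dep {}" by (auto simp: W.lin_dep_def)
  qed
  then obtain S where S: "finite S" "W.basis S" using W.max_li_is_basis by blast
  have "card S = 2" using W.dim_basis[OF S] dim by (simp add: matrix_subspace_dim_def)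
  then obtain A B where AB: "S = {A, B}" "A \<noteq> B" by (auto simp: card_2_iff)
  have SM: "S \<subseteq> M" and ind: "\<not> lin_dep S" and gen: "span S = M"
    using S(2) li sp unfolding W.basis_def by auto
  have c: "A \<in> carrier_mat n n" "B \<in> carrier_mat n n" using SM Mc AB by auto
  have lc: "lincomb f S = f A \<cdot>\<^sub>m A + f B \<cdot>\<^sub>m B" for f
  proof -
    have "lincomb f ({B} \<union> {A}) = f A \<cdot>\<^sub>m A + lincomb f {B}"
      by (rule lincomb_insert) (use c AB in auto)
    moreover have "lincomb f ({} \<union> {B}) = f B \<cdot>\<^sub>m B + lincomb f {}"
      by (rule lincomb_insert) (use c in auto)
    moreover have "lincomb f {} = 0\<^sub>m n n" by (simp add: lincomb_def)
    ultimately show ?thesis using c AB by (simp add: insert_commute)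
  qed
  have span_eq: "M = {a \<cdot>\<^sub>m A + b \<cdot>\<^sub>m B | a b. True}"
  proof
    show "M \<subseteq> {a \<cdot>\<^sub>m A + b \<cdot>\<^sub>m B | a b. True}"
    proof
      fix X assume "X \<in> M"
      hence "X \<in> span S" using gen by simp
      then obtain f where "lincomb f S = X" using finite_in_span[OF S(1)] SM Mc by blast
      thus "X \<in> {a \<cdot>\<^sub>m A + b \<cdot>\<^sub>m B | a b. True}" using lc by blast
    qed
    show "{a \<cdot>\<^sub>m A + b \<cdot>\<^sub>m B | a b. True} \<subseteq> M"
      using subm SM AB unfolding submodule_def by (auto simp: matrix_vs_simps)
  qed
  have "a = 0 \<and> b = 0" if 0: "a \<cdot>\<^sub>m A + b \<cdot>\<^sub>m B = 0\<^sub>m n n" for a b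
  proof (rule ccontr)
    assume ne: "\<not> (a = 0 \<and> b = 0)"
    define f where "f X = (if X = A then a else b)" for X
    have l0: "lincomb f S = 0\<^sub>m n n" using lc[of f] 0 AB(2) by (simp add: f_def)
    have "\<exists>v\<in>S. f v \<noteq> 0" using ne AB by (auto simp: f_def)
    then obtain v where "v \<in> S" "f v \<noteq> 0" by blast
    hence "lin_dep S" using lin_dep_crit[of S S f v] S(1) l0 by auto
    thus False using ind by simp
  qed
  thus ?thesis using c span_eq by blast
qed

lemma F_mat_smult:
  fixes a b t :: "'a::field"
  shows "F_mat (t * a) (t * b) rs = t \<cdot>\<^sub>m F_mat a b rs"
proof -
  have F: "F_bar (t * a) (t * b) rs = t \<cdot>\<^sub>m F_bar a b rs"
    unfolding F_bar_linear[of "t * a"] F_bar_linear[of a]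
    by (intro eq_matI) (auto simp: algebra_simps)
  show ?thesis unfolding F_mat_def Let_def F by (intro eq_matI) auto
qed

lemma congruence_smult:
  fixes P X :: "'a::comm_ring_1 mat"
  assumes P: "P \<in> carrier_mat n n" and X: "X \<in> carrier_mat n n"
  shows "(c \<cdot>\<^sub>m P)\<^sup>T * X * (c \<cdot>\<^sub>m P) = (c * c) \<cdot>\<^sub>m (P\<^sup>T * X * P)"
proof -
  have PT: "P\<^sup>T \<in> carrier_mat n n" using P by simp
  have PX: "P\<^sup>T * X \<in> carrier_mat n n" using PT X by simp
  have "(c \<cdot>\<^sub>m P)\<^sup>T = c \<cdot>\<^sub>m P\<^sup>T" using P by (intro eq_matI) auto
  hence "(c \<cdot>\<^sub>m P)\<^sup>T * X * (c \<cdot>\<^sub>m P) = c \<cdot>\<^sub>m (P\<^sup>T * X) * (c \<cdot>\<^sub>m P)"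
    using mult_smult_assoc_mat[OF PT X] by simp
  also have "\<dots> = c \<cdot>\<^sub>m (P\<^sup>T * X * (c \<cdot>\<^sub>m P))"
    using mult_smult_assoc_mat[OF PX, of "c \<cdot>\<^sub>m P" n] P by simp
  also have "P\<^sup>T * X * (c \<cdot>\<^sub>m P) = c \<cdot>\<^sub>m (P\<^sup>T * X * P)" by (rule mult_smult_distrib[OF PX P])
  also have "c \<cdot>\<^sub>m (c \<cdot>\<^sub>m (P\<^sup>T * X * P)) = (c * c) \<cdot>\<^sub>m (P\<^sup>T * X * P)"
    by (intro eq_matI) (auto simp: mult.assoc)
  finally show ?thesis .
qed

section \<open>The classification\<close>

theorem theorem2p12:
  fixes M :: "'a :: {alg_closed_field, field_char_0} mat set"
    and N r :: nat
  assumes "r \<ge> 1"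
    and "matrix_subspace (N + 1) M"
    and "matrix_subspace_dim (N + 1) M = 2"
    and "\<forall>A\<in>M. skew_symmetric_mat A"
    and "constant_rank (N + 1) (2 * r) M"
    and "nondegenerate_space (N + 1) M"
  shows "\<exists>rs P. decreasing_partition r rs \<and> N = 2 * r + length rs - 1 \<and>
           P \<in> special_linear (N + 1) \<and>
           congruence_action P M = M_pencil rs"
proof -
  define n where "n = N + 1"
  obtain A B where A: "A \<in> carrier_mat n n" and B: "B \<in> carrier_mat n n"
    and M: "M = {a \<cdot>\<^sub>m A + b \<cdot>\<^sub>m B | a b. True}"
    and ind: "\<And>a b. a \<cdot>\<^sub>m A + b \<cdot>\<^sub>m B = 0\<^sub>m n n \<Longrightarrow> a = 0 \<and> b = 0"
    using matrix_subspace_two_basis[OF assms(2,3)[folded n_def]] by blast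
  have inM: "a \<cdot>\<^sub>m A + b \<cdot>\<^sub>m B \<in> M" for a b using M by blast
  have "A = 1 \<cdot>\<^sub>m A + 0 \<cdot>\<^sub>m B" "B = 0 \<cdot>\<^sub>m A + 1 \<cdot>\<^sub>m B" using A B by (auto intro!: eq_matI)
  hence AM: "A \<in> M" "B \<in> M" using inM by metis+
  have skew: "skew_symmetric_mat A" "skew_symmetric_mat B" using AM assms(4) by auto
  have rank: "2 * r + kernel_dim (a \<cdot>\<^sub>m A + b \<cdot>\<^sub>m B) = n" if "(a, b) \<noteq> (0, 0)" for a b
  proof -
    have c: "a \<cdot>\<^sub>m A + b \<cdot>\<^sub>m B \<in> carrier_mat n n" using A B by simp
    have "a \<cdot>\<^sub>m A + b \<cdot>\<^sub>m B \<noteq> 0\<^sub>m n n" using ind[of a b] that by auto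
    hence "vec_space.rank n (a \<cdot>\<^sub>m A + b \<cdot>\<^sub>m B) = 2 * r"
      using assms(5) inM unfolding constant_rank_def n_def by blast
    thus ?thesis using rank_plus_kernel_dim[OF c] by simp
  qed
  hence const: "kernel_dim (a \<cdot>\<^sub>m A + b \<cdot>\<^sub>m B) = n - 2 * r" if "(a, b) \<noteq> (0, 0)" for a b
    using that by (metis diff_add_inverse)
  have nondeg: "v = 0\<^sub>v n" if v: "v \<in> carrier_vec n" "A *\<^sub>v v = 0\<^sub>v n" "B *\<^sub>v v = 0\<^sub>v n" for v
  proof -
    have "(a \<cdot>\<^sub>m A + b \<cdot>\<^sub>m B) *\<^sub>v v = 0\<^sub>v n" for a b
      using A B v by (auto simp: add_mult_distrib_mat_vec[of _ n n] smult_mat_mult_vec[of _ n n])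
    hence "v \<in> mat_kernel X" if "X \<in> M" for X
      using that v(1) A B unfolding M by (auto intro!: mat_kernelI[of _ n n])
    thus ?thesis using assms(6) unfolding nondegenerate_space_def n_def by blast
  qed
  obtain rs ys xs where nb: "normal_basis n A B rs ys xs"
    and n: "n = 2 * sum_list rs + length rs" "length rs = n - 2 * r"
    and rs: "sorted_wrt (\<ge>) rs" "\<forall>j\<in>set rs. 1 \<le> j"
    using normal_basis_exists[OF A B skew const nondeg] by blast
  have "2 * r \<le> n" using rank[of 1 0] by simp
  hence r: "sum_list rs = r" using n by arith
  obtain \<phi>s \<chi>s where us: "set ys \<subseteq> carrier_vec n" "length ys = sum_list rs"
    and vs: "set xs \<subseteq> carrier_vec n" "length xs = sum_list rs + length rs"
    and gA: "gram A ys ys = 0\<^sub>m (length ys) (length ys)" "gram A xs xs = 0\<^sub>m (length xs) (length xs)"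
      "gram A ys xs = F_bar 1 0 rs"
    and gB: "gram B ys ys = 0\<^sub>m (length ys) (length ys)" "gram B xs xs = 0\<^sub>m (length xs) (length xs)"
      "gram B ys xs = F_bar 0 1 rs"
    and d: "set \<phi>s \<subseteq> carrier_vec n" "set \<chi>s \<subseteq> carrier_vec n" "length \<phi>s = length ys" "length \<chi>s = length xs"
      "gram (1\<^sub>m n) \<phi>s ys = 1\<^sub>m (length ys)" "gram (1\<^sub>m n) \<phi>s xs = 0\<^sub>m (length ys) (length xs)"
      "gram (1\<^sub>m n) \<chi>s ys = 0\<^sub>m (length xs) (length ys)" "gram (1\<^sub>m n) \<chi>s xs = 1\<^sub>m (length xs)"
    using nb unfolding normal_basis_def by auto
  define P0 where "P0 = mat_of_cols n (ys @ xs)"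
  define Q0 where "Q0 = (mat_of_cols n (\<phi>s @ \<chi>s))\<^sup>T"
  have len: "length ys + length xs = n" using us(2) vs(2) n(1) by linarith
  have P0: "P0 \<in> carrier_mat n n" and Q0: "Q0 \<in> carrier_mat n n"
    using len d(3,4) by (auto simp: P0_def Q0_def)
  have bc: "set (ys @ xs) \<subseteq> carrier_vec n" and dc: "set (\<phi>s @ \<chi>s) \<subseteq> carrier_vec n" using us vs d by auto
  have "Q0 * 1\<^sub>m n * P0 = gram (1\<^sub>m n) (\<phi>s @ \<chi>s) (ys @ xs)"
    unfolding P0_def Q0_def by (rule gram_eq_mult[symmetric, OF one_carrier_mat dc bc])
  also have "\<dots> = 1\<^sub>m n" unfolding gram_append d(5-8) four_block_one_mat len ..
  finally have "Q0 * P0 = 1\<^sub>m n" using Q0 by simp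
  hence "det Q0 * det P0 = 1" using det_mult[OF Q0 P0] by simp
  hence det: "det P0 \<noteq> 0" by auto
  have cong: "P0\<^sup>T * (a \<cdot>\<^sub>m A + b \<cdot>\<^sub>m B) * P0 = F_mat a b rs" for a b
  proof -
    have X: "a \<cdot>\<^sub>m A + b \<cdot>\<^sub>m B \<in> carrier_mat n n" using A B by simp
    show ?thesis
      using gram_normal_basis[OF A B skew us vs gA gB] gram_eq_mult[OF X bc bc] by (simp add: P0_def)
  qed
  \<comment> \<open>The normal basis has determinant \<open>det P0\<close>; scaling all its vectors by \<open>c\<close> multiplies that by \<open>c ^ n\<close>.\<close>
  obtain c where c: "c ^ n = 1 / det P0" using nth_root_exists[of n "1 / det P0"] by (auto simp: n_def)
  have c0: "c \<noteq> 0" using c det by (auto simp: n_def)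
  have "det (c \<cdot>\<^sub>m P0) = 1" using P0 c det by simp
  hence P: "c \<cdot>\<^sub>m P0 \<in> special_linear n" using P0 by (simp add: special_linear_def)
  have F: "(c \<cdot>\<^sub>m P0)\<^sup>T * (a \<cdot>\<^sub>m A + b \<cdot>\<^sub>m B) * (c \<cdot>\<^sub>m P0) = F_mat (c * c * a) (c * c * b) rs" for a b
  proof -
    have X: "a \<cdot>\<^sub>m A + b \<cdot>\<^sub>m B \<in> carrier_mat n n" using A B by simp
    show ?thesis unfolding congruence_smult[OF P0 X] cong F_mat_smult ..
  qed
  have "congruence_action (c \<cdot>\<^sub>m P0) M = M_pencil rs"
  proof
    show "congruence_action (c \<cdot>\<^sub>m P0) M \<subseteq> M_pencil rs"
      unfolding congruence_action_def M_pencil_def M using F by blast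
    show "M_pencil rs \<subseteq> congruence_action (c \<cdot>\<^sub>m P0) M"
    proof
      fix X :: "'a mat" assume "X \<in> M_pencil rs"
      then obtain a b where X: "X = F_mat a b rs" unfolding M_pencil_def by blast
      have "X = (c \<cdot>\<^sub>m P0)\<^sup>T * ((a / (c * c)) \<cdot>\<^sub>m A + (b / (c * c)) \<cdot>\<^sub>m B) * (c \<cdot>\<^sub>m P0)"
        unfolding F X using c0 by simp
      thus "X \<in> congruence_action (c \<cdot>\<^sub>m P0) M" unfolding congruence_action_def using inM by blast
    qed
  qed
  moreover have "decreasing_partition r rs" using r rs by (simp add: decreasing_partition_def)
  moreover have "N = 2 * r + length rs - 1" using n(1) r unfolding n_def by arith
  ultimately show ?thesis using P unfolding n_def by blast
qed

end
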